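(* Suppose that assumptions (A1), (A2), (A3) stated in the context hold. Let $\delta=\sqrt{\epsilon}$, $\Delta=2\sqrt{\epsilon}/L_H$, $\nu\in(0,1/2)$, and let the backtracking line search parameters satisfy $\beta\in(0,1)$ and $\gamma>0$, where $\epsilon>0$ is sufficiently small. Then the algorithm SOBASIP described in the context terminates in at most $O\left(\epsilon^{-3/2}\log_\beta(\epsilon)\right)$ steps, and the iterate $x_{k+1}$ it returns is an $\epsilon$-approximate second-order stationary point, i.e. $\|\overline g(x_{k+1})\|\le O(\epsilon)$ and $\lambda_1(\overline B(x_{k+1}))\ge \Omega(-\sqrt{\epsilon})$. Specifically, the number of iterations is bounded by $$O\left(\max\left\{\frac{3L_H^3}{4\gamma\underline{\alpha}^3},\ \frac{2(L_H\gamma_D^3+\gamma)^3}{9\gamma\beta^3}\right\}\left\lceil \log_\beta\left(\frac{3\sqrt{\epsilon}\,\nu}{L_H\gamma_D^3+\gamma}\right)\right\rceil\left(f(x_1)-f_{\inf}\right)\epsilon^{-3/2}\right).$$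
   Context: Problem. Minimise $f:\mathbb R^n\to\mathbb R$ over $\mathcal F=\{x: l\le x\le u\}$, where $l\in(\mathbb R\cup\{-\infty\})^n$, $u\in(\mathbb R\cup\{+\infty\})^n$, $l<u$; $\mathrm{int}(\mathcal F)=\{x:l<x<u\}$. Write $g=\nabla f$, $H=\nabla^2 f$; superscript $i$ denotes the $i$-th component; $f_{\inf}$ denotes the infimum of $f$ over $\mathcal F$ (assumed finite). $\|\cdot\|$ is the Euclidean norm or its induced matrix norm; $\lambda_1(\cdot)$ is the smallest eigenvalue of a symmetric matrix. Affine scaling. $v^i(x)=x^i-u^i$ if $g^i(x)<0,\ u^i<\infty$; $v^i(x)=x^i-l^i$ if $g^i(x)\ge0,\ l^i>-\infty$; $v^i(x)=-1$ if $g^i(x)<0,\ u^i=\infty$; $v^i(x)=1$ if $g^i(x)\ge0,\ l^i=-\infty$. $D(x)=\mathrm{diag}(|v(x)|^{-1/2})$, so $D^{-1}(x)=\mathrm{diag}(|v^i(x)|^{1/2})$. $J^v(x)$ is the diagonal matrix whose $i$-th entry (the derivative of $|v^i|$ with respect to $x^i$) is $1$ if $g^i(x)\ge0,\ l^i>-\infty$; $-1$ if $g^i(x)<0,\ u^i<\infty$; $0$ otherwise. $\overline g(x)=D^{-1}(x)g(x)$, $\overline C(x)=\mathrm{diag}(g(x))J^v(x)$, $\overline B(x)=D^{-1}(x)H(x)D^{-1}(x)+\overline C(x)$. A subscript $k$ means evaluation at $x_k$. Subproblem. $[s_k;t_k]$ ($s_k\in\mathbb R^n,t_k\in\mathbb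 R$) is an optimal solution of $\min_{\|[s;t]\|\le1}[s;t]^TF_k[s;t]$ with $F_k=\begin{bmatrix}\overline B_k&\overline g_k\\ \overline g_k^T&-\delta\end{bmatrix}$. Algorithm SOBASIP. Parameters: $\nu\in(0,1/2)$, $\gamma>0$, $\beta\in(0,1)$, $\tau\in(0,1)$, $\Delta>0$, $\delta$; the initial point lies in $\mathrm{int}(\mathcal F)$. At iteration $k=1,2,\dots$: compute $[s_k;t_k]$. If $|t_k|>\sqrt{1/(1+\Delta^2)}$, set $\overline d_k=s_k/t_k$, $d_k=D_k^{-1}\overline d_k$, $x_{k+1}=x_k+d_k$, return $x_{k+1}$ and terminate. Otherwise set $\overline d_k=s_k/t_k$ if $|t_k|\ge\nu$, and $\overline d_k=\mathrm{sign}(-\overline g_k^Ts_k)\,s_k$ if $|t_k|<\nu$ (with $\mathrm{sign}(0)=1$); set $d_k=D_k^{-1}\overline d_k$; let $\alpha_k^{\max}=\min_{1\le i\le n}\max\{(l^i-x_k^i)/d_k^i,(u^i-x_k^i)/d_k^i\}$ (the largest step keeping $x_k+\alpha d_k$ in $\mathcal F$; indices with $d_k^i=0$ impose no restriction), $\alpha_{k,0}=\tau\min\{1,\alpha_k^{\max}\}$, and backtrack: $\alpha_{k,j}=\beta^j\alpha_{k,0}$, $j=0,1,\dots$, until $f(x_k+\alpha_{k,j}d_k)-f(x_k)\le-\frac{\gamma}{6}\alpha_{k,j}^3\|\overline d_k\|^3$; take the first such $\alpha_{k,j}$ as $\alpha_k$ and set $x_{k+1}=x_k+\alpha_kd_k$.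 Assumptions. (A1) There is a bounded closed set $X\subset\mathrm{int}(\mathcal F)$ containing all iterates $x_k$. (A2) $f$ is thrice continuously differentiable on $X$; there is $L_H>0$ with $\|H(x)-H(y)\|\le L_H\|x-y\|$ for all $x,y\in X$; and there is $U_H>0$ with $\|H_k\|\le U_H$ for all $k$. (A3) There are $\gamma_D,\gamma_B>0$ with $\|D_k^{-1}\|\le\gamma_D$ and $\|\overline B_k\|\le\gamma_B$ for all $k$. The constant $\underline\alpha>0$ is a uniform lower bound for the initial step sizes: $\alpha_{k,0}\ge\underline\alpha>0$ for all $k$ (such a bound exists by (A1) and boundedness of $\|d_k\|$). The hidden constants in $O(\cdot)$ and $\Omega(\cdot)$ do not depend on $\epsilon$; $\lambda_1\ge\Omega(-\sqrt\epsilon)$ means $\lambda_1\ge -c\sqrt\epsilon$ for some constant $c>0$. "Steps" counts backtracking steps as well.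
   Formalization: The explicit iteration bound is stated as the maximum of 1 and the displayed O(...) expression, because when f(x_1) = f_inf the displayed expression is 0 although the algorithm still performs one terminating iteration. *)

theory Defs
  imports "HOL-Analysis.Analysis"
begin

definition feasible :: "ereal^'n \<Rightarrow> ereal^'n \<Rightarrow> (real^'n) set" where
  "feasible l u = {x. \<forall>i. l $ i \<le> ereal (x $ i) \<and> ereal (x $ i) \<le> u $ i}"

definition strictly_feasible :: "ereal^'n \<Rightarrow> ereal^'n \<Rightarrow> (real^'n) set" where
  "strictly_feasible l u = {x. \<forall>i. l $ i < ereal (x $ i) \<and> ereal (x $ i) < u $ i}"

definition partial_deriv :: "(real^'n \<Rightarrow> real) \<Rightarrow> 'n \<Rightarrow> real^'n \<Rightarrow> real" where
  "partial_deriv f i x = frechet_derivative f (at x) (axis i 1)"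

definition grad :: "(real^'n \<Rightarrow> real) \<Rightarrow> real^'n \<Rightarrow> real^'n" where
  "grad f x = (\<chi> i. partial_deriv f i x)"

definition hess :: "(real^'n \<Rightarrow> real) \<Rightarrow> real^'n \<Rightarrow> real^'n^'n" where
  "hess f x = jacobian (grad f) (at x)"

fun C_k_on_open :: "nat \<Rightarrow> (real^'n \<Rightarrow> real) \<Rightarrow> (real^'n) set \<Rightarrow> bool" where
  "C_k_on_open 0 f S \<longleftrightarrow> continuous_on S f"
| "C_k_on_open (Suc m) f S \<longleftrightarrow>
     (\<forall>x\<in>S. f differentiable (at x)) \<and> (\<forall>i. C_k_on_open m (partial_deriv f i) S)"

text \<open>As usual, a function is of class \<open>C\<^sup>k\<close> on a set that need not be open if it is of
  class \<open>C\<^sup>k\<close> on an open set containing it.\<close>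

definition C_k_on :: "nat \<Rightarrow> (real^'n \<Rightarrow> real) \<Rightarrow> (real^'n) set \<Rightarrow> bool" where
  "C_k_on m f X \<longleftrightarrow> (\<exists>S. open S \<and> X \<subseteq> S \<and> C_k_on_open m f S)"

text \<open>The induced matrix norm; the library's \<open>norm\<close> on matrices is the Frobenius norm.\<close>

definition opnorm :: "real^'n^'n \<Rightarrow> real" where
  "opnorm A = onorm (\<lambda>v. A *v v)"

definition lambda_min :: "real^'n^'n \<Rightarrow> real" where
  "lambda_min A = Min {a. \<exists>v. v \<noteq> 0 \<and> A *v v = a *\<^sub>R v}"

definition diag :: "real^'n \<Rightarrow> real^'n^'n" where
  "diag a = (\<chi> i j. if i = j then a $ i else 0)"

definition scaling_v :: "(real^'n \<Rightarrow> real) \<Rightarrow> ereal^'n \<Rightarrow> ereal^'n \<Rightarrow> real^'n \<Rightarrow> real^'n" where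
  "scaling_v f l u x = (\<chi> i.
     if grad f x $ i < 0
     then (if u $ i < \<infinity> then x $ i - real_of_ereal (u $ i) else - 1)
     else (if l $ i > - \<infinity> then x $ i - real_of_ereal (l $ i) else 1))"

definition D_inv :: "(real^'n \<Rightarrow> real) \<Rightarrow> ereal^'n \<Rightarrow> ereal^'n \<Rightarrow> real^'n \<Rightarrow> real^'n^'n" where
  "D_inv f l u x = diag (\<chi> i. sqrt \<bar>scaling_v f l u x $ i\<bar>)"

definition Jv :: "(real^'n \<Rightarrow> real) \<Rightarrow> ereal^'n \<Rightarrow> ereal^'n \<Rightarrow> real^'n \<Rightarrow> real^'n^'n" where
  "Jv f l u x = diag (\<chi> i.
     if grad f x $ i \<ge> 0 \<and> l $ i > - \<infinity> then 1
     else if grad f x $ i < 0 \<and> u $ i < \<infinity> then - 1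
     else 0)"

definition g_bar :: "(real^'n \<Rightarrow> real) \<Rightarrow> ereal^'n \<Rightarrow> ereal^'n \<Rightarrow> real^'n \<Rightarrow> real^'n" where
  "g_bar f l u x = D_inv f l u x *v grad f x"

definition C_bar :: "(real^'n \<Rightarrow> real) \<Rightarrow> ereal^'n \<Rightarrow> ereal^'n \<Rightarrow> real^'n \<Rightarrow> real^'n^'n" where
  "C_bar f l u x = diag (grad f x) ** Jv f l u x"

definition B_bar :: "(real^'n \<Rightarrow> real) \<Rightarrow> ereal^'n \<Rightarrow> ereal^'n \<Rightarrow> real^'n \<Rightarrow> real^'n^'n" where
  "B_bar f l u x = D_inv f l u x ** hess f x ** D_inv f l u x + C_bar f l u x"

text \<open>Block vectors and matrices of size \<open>n + 1\<close> are indexed by \<open>'n option\<close>, where \<open>None\<close> is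
  the last index.\<close>

definition block_vec :: "real^'n \<Rightarrow> real \<Rightarrow> real^('n option)" where
  "block_vec s t = (\<chi> i. case i of Some a \<Rightarrow> s $ a | None \<Rightarrow> t)"

definition block_mat :: "real^'n^'n \<Rightarrow> real^'n \<Rightarrow> real \<Rightarrow> real^('n option)^('n option)" where
  "block_mat B g c = (\<chi> i j. case (i, j) of
     (Some a, Some b) \<Rightarrow> B $ a $ b
   | (Some a, None) \<Rightarrow> g $ a
   | (None, Some b) \<Rightarrow> g $ b
   | (None, None) \<Rightarrow> c)"

definition subproblem_solution ::
  "(real^'n \<Rightarrow> real) \<Rightarrow> ereal^'n \<Rightarrow> ereal^'n \<Rightarrow> real \<Rightarrow> real^'n \<Rightarrow> real^'n \<Rightarrow> real \<Rightarrow> bool" where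
  "subproblem_solution f l u \<delta> x s t \<longleftrightarrow>
     (let F = block_mat (B_bar f l u x) (g_bar f l u x) (- \<delta>);
          w = block_vec s t
      in norm w \<le> 1 \<and> (\<forall>y. norm y \<le> 1 \<longrightarrow> w \<bullet> (F *v w) \<le> y \<bullet> (F *v y)))"

record sobasip_params =
  par_nu :: real
  par_gamma :: real
  par_beta :: real
  par_tau :: real
  par_Delta :: real
  par_delta :: real

definition stops :: "sobasip_params \<Rightarrow> real \<Rightarrow> bool" where
  "stops p t \<longleftrightarrow> \<bar>t\<bar> > sqrt (1 / (1 + (par_Delta p)\<^sup>2))"

definition d_bar ::
  "(real^'n \<Rightarrow> real) \<Rightarrow> ereal^'n \<Rightarrow> ereal^'n \<Rightarrow> sobasip_params \<Rightarrow> real^'n \<Rightarrow> real^'n \<Rightarrow> real \<Rightarrow> real^'n"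
where
  "d_bar f l u p x s t =
     (if stops p t \<or> \<bar>t\<bar> \<ge> par_nu p then (1 / t) *\<^sub>R s
      else if - (g_bar f l u x \<bullet> s) \<ge> 0 then s else - s)"

definition direction ::
  "(real^'n \<Rightarrow> real) \<Rightarrow> ereal^'n \<Rightarrow> ereal^'n \<Rightarrow> sobasip_params \<Rightarrow> real^'n \<Rightarrow> real^'n \<Rightarrow> real \<Rightarrow> real^'n"
where
  "direction f l u p x s t = D_inv f l u x *v d_bar f l u p x s t"

text \<open>The infimum over the empty index set is \<open>\<infinity>\<close>.\<close>

definition alpha_max :: "ereal^'n \<Rightarrow> ereal^'n \<Rightarrow> real^'n \<Rightarrow> real^'n \<Rightarrow> ereal" where
  "alpha_max l u x d =
     (INF i\<in>{i. d $ i \<noteq> 0}.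
        max ((l $ i - ereal (x $ i)) / ereal (d $ i)) ((u $ i - ereal (x $ i)) / ereal (d $ i)))"

definition alpha_trial ::
  "(real^'n \<Rightarrow> real) \<Rightarrow> ereal^'n \<Rightarrow> ereal^'n \<Rightarrow> sobasip_params \<Rightarrow> real^'n \<Rightarrow> real^'n \<Rightarrow> real \<Rightarrow> nat \<Rightarrow> real"
where
  "alpha_trial f l u p x s t j =
     par_beta p ^ j *
     (par_tau p * real_of_ereal (min 1 (alpha_max l u x (direction f l u p x s t))))"

definition accepts ::
  "(real^'n \<Rightarrow> real) \<Rightarrow> ereal^'n \<Rightarrow> ereal^'n \<Rightarrow> sobasip_params \<Rightarrow> real^'n \<Rightarrow> real^'n \<Rightarrow> real \<Rightarrow> nat \<Rightarrow> bool"
where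
  "accepts f l u p x s t j \<longleftrightarrow>
     (let a = alpha_trial f l u p x s t j
      in f (x + a *\<^sub>R direction f l u p x s t) - f x
         \<le> - (par_gamma p / 6) * a ^ 3 * norm (d_bar f l u p x s t) ^ 3)"

definition search_index ::
  "(real^'n \<Rightarrow> real) \<Rightarrow> ereal^'n \<Rightarrow> ereal^'n \<Rightarrow> sobasip_params \<Rightarrow> real^'n \<Rightarrow> real^'n \<Rightarrow> real \<Rightarrow> nat"
where
  "search_index f l u p x s t = (LEAST j. accepts f l u p x s t j)"

text \<open>An execution is given by sequences \<open>x\<close>, \<open>s\<close>, \<open>t\<close> indexed from 1. Iteration \<open>k\<close> is
  reached if no earlier iteration stops the algorithm or has an endless line search; the sequences
  are unconstrained beyond that point. So neither the termination of the line searches nor that of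
  the algorithm is built into the definition of an execution.\<close>

definition reaches ::
  "(real^'n \<Rightarrow> real) \<Rightarrow> ereal^'n \<Rightarrow> ereal^'n \<Rightarrow> sobasip_params \<Rightarrow>
   (nat \<Rightarrow> real^'n) \<Rightarrow> (nat \<Rightarrow> real^'n) \<Rightarrow> (nat \<Rightarrow> real) \<Rightarrow> nat \<Rightarrow> bool"
where
  "reaches f l u p x s t k \<longleftrightarrow>
     1 \<le> k \<and> (\<forall>j\<in>{1..<k}. \<not> stops p (t j) \<and> (\<exists>i. accepts f l u p (x j) (s j) (t j) i))"

definition sobasip_run ::
  "(real^'n \<Rightarrow> real) \<Rightarrow> ereal^'n \<Rightarrow> ereal^'n \<Rightarrow> sobasip_params \<Rightarrow>
   (nat \<Rightarrow> real^'n) \<Rightarrow> (nat \<Rightarrow> real^'n) \<Rightarrow> (nat \<Rightarrow> real) \<Rightarrow> bool"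
where
  "sobasip_run f l u p x s t \<longleftrightarrow>
     x 1 \<in> strictly_feasible l u \<and>
     (\<forall>k. reaches f l u p x s t k \<longrightarrow>
        subproblem_solution f l u (par_delta p) (x k) (s k) (t k) \<and>
        (if stops p (t k)
         then x (Suc k) = x k + direction f l u p (x k) (s k) (t k)
         else (\<exists>i. accepts f l u p (x k) (s k) (t k) i) \<longrightarrow>
              x (Suc k) = x k +
                alpha_trial f l u p (x k) (s k) (t k) (search_index f l u p (x k) (s k) (t k))
                  *\<^sub>R direction f l u p (x k) (s k) (t k)))"

definition terminates_at ::
  "(real^'n \<Rightarrow> real) \<Rightarrow> ereal^'n \<Rightarrow> ereal^'n \<Rightarrow> sobasip_params \<Rightarrow>
   (nat \<Rightarrow> real^'n) \<Rightarrow> (nat \<Rightarrow> real^'n) \<Rightarrow> (nat \<Rightarrow> real) \<Rightarrow> nat \<Rightarrow> bool"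
where
  "terminates_at f l u p x s t k \<longleftrightarrow> reaches f l u p x s t k \<and> stops p (t k)"

text \<open>The indices of all points generated, including the returned one.\<close>

definition iterate_indices ::
  "(real^'n \<Rightarrow> real) \<Rightarrow> ereal^'n \<Rightarrow> ereal^'n \<Rightarrow> sobasip_params \<Rightarrow>
   (nat \<Rightarrow> real^'n) \<Rightarrow> (nat \<Rightarrow> real^'n) \<Rightarrow> (nat \<Rightarrow> real) \<Rightarrow> nat set"
where
  "iterate_indices f l u p x s t =
     {k. reaches f l u p x s t k} \<union> Suc ` {k. terminates_at f l u p x s t k}"

text \<open>Every iteration counts as one step, and so does every step size tried by a line search.\<close>

definition num_steps ::
  "(real^'n \<Rightarrow> real) \<Rightarrow> ereal^'n \<Rightarrow> ereal^'n \<Rightarrow> sobasip_params \<Rightarrow>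
   (nat \<Rightarrow> real^'n) \<Rightarrow> (nat \<Rightarrow> real^'n) \<Rightarrow> (nat \<Rightarrow> real) \<Rightarrow> nat \<Rightarrow> nat"
where
  "num_steps f l u p x s t K =
     K + (\<Sum>k\<in>{1..<K}. Suc (search_index f l u p (x k) (s k) (t k)))"

end

theory Submission
  imports Defs
begin

text \<open>
  An optimal \<open>[s; t]\<close> of the subproblem is a unit eigenvector of \<open>F\<close> for its least eigenvalue
  \<open>- \<theta> \<le> - \<delta>\<close>. Reading off the blocks, along either kind of direction the quadratic model decreases
  by at least \<open>\<theta> \<alpha>\<^sup>2 \<parallel>d\<parallel>\<^sup>2 / 2\<close> (with \<open>d\<close> the scaled direction), so Taylor's theorem makes the cubic
  decrease test succeed as soon as \<open>\<alpha> \<parallel>d\<parallel> \<le> 3 \<surd>\<epsilon> / (M \<gamma>\<^sub>D\<^sup>3 + \<gamma>)\<close>. As \<open>\<parallel>d\<parallel> \<ge> 2 \<surd>\<epsilon> / L\<^sub>H\<close> until the algorithm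
  stops, every iteration decreases \<open>f\<close> by a multiple of \<open>\<epsilon>\<^sup>3\<^sup>/\<^sup>2\<close>. Trial points need not lie in \<open>X\<close>, so \<open>M\<close> is
  a bound on the third derivatives on a compact neighbourhood of \<open>X\<close> rather than \<open>L\<^sub>H\<close>; the quotient
  \<open>M / L\<^sub>H\<close> only depends on \<open>f\<close> and \<open>X\<close> and is absorbed into the constant \<open>C\<^sub>0\<close>. At a stop,
  \<open>\<parallel>d\<parallel> \<le> 2 \<surd>\<epsilon> / L\<^sub>H\<close>, and the eigenvector equations give stationarity of the next point.
\<close>

section \<open>Symmetric matrices and quadratic forms\<close>

text \<open>The delicate point is uniformity. \<open>C\<^sub>0\<close> is fixed before the
  algorithmic parameters, so it can only contain \<kappa> = max 1 (M / \<open>L\<^sub>H\<close>).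
  This ratio enters cubed through the decrease per iteration, and additively as a shift by
  log_\<beta>(1/\<kappa>) of the logarithm that counts backtracking steps. The shift depends on
  \<beta> and cannot go into \<open>C\<^sub>0\<close>; the logarithm itself outgrows it for small
  \<epsilon>, at the price of a factor 2. \<open>C\<close> and \<open>\<epsilon>\<^sub>0\<close> may
  use the parameters but not the run, so f(x_1) is replaced by an upper bound of f on the compact
  set X, and the initial step sizes are bounded below through the distance of X to the boundary. As
  X need not be convex, \<open>L\<^sub>H\<close> serves as a Lipschitz constant only for the final
  step, both of whose ends lie in X.\<close>

lemma symmetric_matrix_inner:
  fixes A :: "real^'n^'n"
  assumes "transpose A = A"
  shows "x \<bullet> (A *v y) = y \<bullet> (A *v x)"
  by (metis assms dot_lmul_matrix inner_commute transpose_matrix_vector)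

lemma norm_matrix_vector_mult_le: "norm (A *v x) \<le> opnorm A * norm x"
  unfolding opnorm_def using onorm[OF matrix_vector_mul_bounded_linear] .

lemma abs_inner_matrix_le:
  fixes A :: "real^'n^'n"
  shows "\<bar>x \<bullet> (A *v x)\<bar> \<le> opnorm A * (norm x)\<^sup>2"
proof -
  have "\<bar>x \<bullet> (A *v x)\<bar> \<le> norm x * norm (A *v x)"
    by (rule Cauchy_Schwarz_ineq2)
  also have "\<dots> \<le> norm x * (opnorm A * norm x)"
    by (intro mult_left_mono norm_matrix_vector_mult_le) simp
  finally show ?thesis by (simp add: power2_eq_square mult_ac)
qed

text \<open>The form of A - cI is nonnegative and vanishes at w, so w minimises it and its first
  variation there is zero. Testing with the residual z = Aw - cw itself turns this into z =
  0.\<close>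

lemma quadratic_form_kernel:
  fixes A :: "real^'n^'n"
  assumes sym: "transpose A = A"
    and nonneg: "\<And>y. y \<bullet> (A *v y) \<ge> c * (y \<bullet> y)"
    and w: "w \<bullet> (A *v w) = c * (w \<bullet> w)"
  shows "A *v w = c *\<^sub>R w"
proof -
  define z where "z = A *v w - c *\<^sub>R w"
  define q where "q = z \<bullet> (A *v z) - c * (z \<bullet> z)"
  have expand: "2 * a * (z \<bullet> z) + a\<^sup>2 * q \<ge> 0" for a
  proof -
    have "0 \<le> (w + a *\<^sub>R z) \<bullet> (A *v (w + a *\<^sub>R z)) - c * ((w + a *\<^sub>R z) \<bullet> (w + a *\<^sub>R z))"
      using nonneg[of "w + a *\<^sub>R z"] by simp
    also have "\<dots> = (w \<bullet> (A *v w) - c * (w \<bullet> w)) + 2 * a * (z \<bullet> (A *v w) - c * (z \<bullet> w)) + a\<^sup>2 * q"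
      using symmetric_matrix_inner[OF sym, of w z]
      by (simp add: q_def matrix_vector_right_distrib matrix_vector_mult_scaleR inner_add
            power2_eq_square inner_commute algebra_simps)
    also have "z \<bullet> (A *v w) - c * (z \<bullet> w) = z \<bullet> z"
      by (simp add: z_def inner_diff_right)
    finally show ?thesis using w by simp
  qed
  have "z \<bullet> z = 0"
  proof (rule ccontr)
    assume "z \<bullet> z \<noteq> 0"
    then have pos: "z \<bullet> z > 0" by simp
    \<comment> \<open>Small and negative enough that the quadratic term a^2 q cancels at most half
      of the linear term 2a(z \<bullet> z).\<close>
    define a where "a = - (z \<bullet> z) / (\<bar>q\<bar> + 1)"
    have a: "a < 0" using pos by (simp add: a_def field_simps)
    have "a\<^sup>2 * q \<le> a\<^sup>2 * (\<bar>q\<bar> + 1)" by (intro mult_left_mono) auto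
    also have "\<dots> = - a * (z \<bullet> z)" by (simp add: a_def power2_eq_square)
    finally have "2 * a * (z \<bullet> z) - a * (z \<bullet> z) \<ge> 0" using expand[of a] by simp
    then have "a * (z \<bullet> z) \<ge> 0" by simp
    with mult_neg_pos[OF a pos] show False by simp
  qed
  then show ?thesis by (simp add: z_def)
qed

text \<open>Eigenvectors for distinct eigenvalues are orthogonal, hence independent, so there are
  finitely many. \<open>lambda_min\<close> is a \<open>Min\<close>, which says nothing about
  infinite or empty sets; this lemma and the next existence result exclude both.\<close>

lemma symmetric_eigenvalues_finite:
  fixes A :: "real^'n^'n"
  assumes sym: "transpose A = A"
  shows "finite {a. \<exists>v. v \<noteq> 0 \<and> A *v v = a *\<^sub>R v}"
proof -
  define E where "E = {a. \<exists>v. v \<noteq> 0 \<and> A *v v = a *\<^sub>R v}"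
  have "\<forall>a\<in>E. \<exists>v. v \<noteq> 0 \<and> A *v v = a *\<^sub>R v" by (simp add: E_def)
  from bchoice[OF this] obtain v where
    v: "\<And>a. a \<in> E \<Longrightarrow> v a \<noteq> 0" "\<And>a. a \<in> E \<Longrightarrow> A *v v a = a *\<^sub>R v a" by blast
  have orth: "v a \<bullet> v b = 0" if "a \<in> E" "b \<in> E" "a \<noteq> b" for a b
  proof -
    have "b * (v a \<bullet> v b) = a * (v b \<bullet> v a)"
      using symmetric_matrix_inner[OF sym, of "v a" "v b"] v(2)[OF that(1)] v(2)[OF that(2)] by simp
    then show ?thesis using that(3) by (simp add: inner_commute)
  qed
  have inj: "inj_on v E"
  proof (intro inj_onI, rule ccontr)
    fix a b assume ab: "a \<in> E" "b \<in> E" "v a = v b" "a \<noteq> b"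
    from orth[OF ab(1,2,4)] v(1)[OF ab(1)] ab(3) show False by simp
  qed
  have "pairwise orthogonal (v ` E)"
    unfolding pairwise_def orthogonal_def using orth by blast
  moreover have "0 \<notin> v ` E" using v(1) by (metis imageE)
  ultimately have "independent (v ` E)"
    by (rule pairwise_orthogonal_independent)
  then have "finite (v ` E)" by (rule finiteI_independent)
  then have "finite E" using inj by (rule finite_imageD)
  then show ?thesis by (simp add: E_def)
qed

lemma quadratic_form_ge_of_sphere:
  fixes A :: "real^'n^'n"
  assumes "\<And>y. norm y = 1 \<Longrightarrow> c \<le> y \<bullet> (A *v y)"
  shows "c * (y \<bullet> y) \<le> y \<bullet> (A *v y)"
proof (cases "y = 0")
  case False
  have "c \<le> (y /\<^sub>R norm y) \<bullet> (A *v (y /\<^sub>R norm y))"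
    using False by (intro assms) simp
  also have "\<dots> = (y \<bullet> (A *v y)) / (norm y)\<^sup>2"
    by (simp add: matrix_vector_mult_scaleR power2_eq_square field_simps)
  finally show ?thesis
    using False by (simp add: field_simps power2_norm_eq_inner)
qed simp

text \<open>A minimiser of the Rayleigh quotient on the unit sphere, which exists by compactness, is
  an eigenvector.\<close>

lemma symmetric_eigenvalue_exists:
  fixes A :: "real^'n^'n"
  assumes sym: "transpose A = A"
  shows "\<exists>a v. v \<noteq> 0 \<and> A *v v = a *\<^sub>R v"
proof -
  have "continuous_on (sphere 0 1) (\<lambda>y. y \<bullet> (A *v y))"
    by (intro continuous_intros)
  moreover have "sphere (0::real^'n) 1 \<noteq> {}" by simp
  ultimately obtain w where w: "norm w = 1" "\<And>y. norm y = 1 \<Longrightarrow> w \<bullet> (A *v w) \<le> y \<bullet> (A *v y)"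
    using continuous_attains_inf[OF compact_sphere, of 0 1 "\<lambda>y. y \<bullet> (A *v y)"] by auto
  then have "A *v w = (w \<bullet> (A *v w)) *\<^sub>R w"
    by (intro quadratic_form_kernel[OF sym] quadratic_form_ge_of_sphere)
       (auto simp: norm_eq_1)
  with w show ?thesis by (metis norm_zero zero_neq_one)
qed

text \<open>The \<open>Min\<close> is attained by an actual eigenvector, and the lower bound on the
  form is tested there.\<close>

lemma lambda_min_ge:
  fixes A :: "real^'n^'n"
  assumes sym: "transpose A = A"
    and ge: "\<And>v. v \<bullet> (A *v v) \<ge> c * (v \<bullet> v)"
  shows "lambda_min A \<ge> c"
proof -
  have "lambda_min A \<in> {a. \<exists>v. v \<noteq> 0 \<and> A *v v = a *\<^sub>R v}"
    unfolding lambda_min_def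
    using symmetric_eigenvalue_exists[OF sym]
    by (intro Min_in symmetric_eigenvalues_finite[OF sym]) auto
  then obtain v where v: "v \<noteq> 0" "A *v v = lambda_min A *\<^sub>R v" by auto
  have "c * (v \<bullet> v) \<le> lambda_min A * (v \<bullet> v)" using ge[of v] v(2) by simp
  then show ?thesis using v(1) by simp
qed

section \<open>The homogenised subproblem\<close>

lemma sum_UNIV_option:
  fixes h :: "'n::finite option \<Rightarrow> real"
  shows "(\<Sum>i\<in>UNIV. h i) = h None + (\<Sum>i\<in>UNIV. h (Some i))"
  by (simp add: UNIV_option_conv sum.reindex)

lemma inner_block_vec: "block_vec s t \<bullet> block_vec s' t' = s \<bullet> s' + t * t'"
  by (simp add: inner_vec_def sum_UNIV_option block_vec_def)

lemma block_mat_mult_block_vec: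
  "block_mat B g c *v block_vec s t = block_vec (B *v s + t *\<^sub>R g) (g \<bullet> s + c * t)"
  by (simp add: vec_eq_iff block_vec_def block_mat_def matrix_vector_mult_def sum_UNIV_option
        inner_vec_def split: option.split)

lemma block_vec_scaleR: "a *\<^sub>R block_vec s t = block_vec (a *\<^sub>R s) (a * t)"
  by (simp add: vec_eq_iff block_vec_def split: option.split)

lemma block_vec_eq_iff: "block_vec s t = block_vec s' t' \<longleftrightarrow> s = s' \<and> t = t'"
  by (auto simp: vec_eq_iff block_vec_def split: option.splits)

lemma transpose_block_mat: "transpose B = B \<Longrightarrow> transpose (block_mat B g c) = block_mat B g c"
  by (auto simp: vec_eq_iff block_mat_def transpose_def split: option.split)

text \<open>The competitor [0; 1] has value -\<delta>, so the minimum m is negative. By homogeneity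
  a negative minimum over the ball is attained on the sphere only, and there
  \<open>quadratic_form_kernel\<close> applies with c = m; \<theta> = -m. The two rows of the
  eigenvector equation are the two equations obtained, and restricting the form to vectors [z; 0]
  gives the curvature bound on \<open>B_bar\<close>.\<close>

lemma subproblem_solution_optimality:
  assumes sol: "subproblem_solution f l u \<delta> x s t"
    and sym: "transpose (B_bar f l u x) = B_bar f l u x"
    and \<delta>: "\<delta> > 0"
  obtains \<theta> where "\<theta> \<ge> \<delta>" "s \<bullet> s + t\<^sup>2 = 1"
    "B_bar f l u x *v s + t *\<^sub>R g_bar f l u x = - \<theta> *\<^sub>R s"
    "g_bar f l u x \<bullet> s = (\<delta> - \<theta>) * t"
    "\<And>z. z \<bullet> (B_bar f l u x *v z) \<ge> - \<theta> * (z \<bullet> z)"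
proof -
  define F where "F = block_mat (B_bar f l u x) (g_bar f l u x) (- \<delta>)"
  define w where "w = block_vec s t"
  have w: "norm w \<le> 1" "\<And>y. norm y \<le> 1 \<Longrightarrow> w \<bullet> (F *v w) \<le> y \<bullet> (F *v y)"
    using sol by (auto simp: subproblem_solution_def Let_def F_def w_def)
  have symF: "transpose F = F" unfolding F_def by (rule transpose_block_mat[OF sym])
  define m where "m = w \<bullet> (F *v w)"
  have "m \<le> block_vec 0 1 \<bullet> (F *v block_vec 0 1)"
    unfolding m_def by (intro w(2)) (simp add: norm_eq_sqrt_inner inner_block_vec)
  also have "\<dots> = - \<delta>" by (simp add: F_def block_mat_mult_block_vec inner_block_vec)
  finally have m: "m \<le> - \<delta>" .
  have ge: "y \<bullet> (F *v y) \<ge> m * (y \<bullet> y)" for y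
    by (rule quadratic_form_ge_of_sphere) (use w(2) in \<open>simp add: m_def\<close>)
  have "m * 1 \<ge> m * (w \<bullet> w)" using ge[of w] by (simp add: m_def)
  then have "w \<bullet> w \<ge> 1" using m \<delta> by (simp add: mult_le_cancel_left)
  moreover have "w \<bullet> w \<le> 1" using w(1) by (simp add: norm_eq_sqrt_inner)
  ultimately have ww: "w \<bullet> w = 1" by simp
  have "F *v w = m *\<^sub>R w"
    by (rule quadratic_form_kernel[OF symF ge]) (simp add: ww m_def)
  then have eq: "B_bar f l u x *v s + t *\<^sub>R g_bar f l u x = m *\<^sub>R s"
      "g_bar f l u x \<bullet> s - \<delta> * t = m * t"
    by (auto simp: F_def w_def block_mat_mult_block_vec block_vec_scaleR block_vec_eq_iff)
  show thesis
  proof (rule that[of "- m"])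
    show "s \<bullet> s + t\<^sup>2 = 1" using ww by (simp add: w_def inner_block_vec power2_eq_square)
    show "z \<bullet> (B_bar f l u x *v z) \<ge> - (- m) * (z \<bullet> z)" for z
      using ge[of "block_vec z 0"]
      by (simp add: F_def block_mat_mult_block_vec inner_block_vec)
  qed (use m eq in \<open>auto simp: algebra_simps\<close>)
qed

section \<open>Second derivatives and Taylor expansion\<close>

lemma frechet_derivative_eq_sum_partial:
  fixes f :: "real^'n \<Rightarrow> real"
  assumes "f differentiable (at y)"
  shows "frechet_derivative f (at y) h = (\<Sum>i\<in>UNIV. partial_deriv f i y * h $ i)"
proof -
  interpret linear "frechet_derivative f (at y)"
    using assms by (rule linear_frechet_derivative)
  have "frechet_derivative f (at y) h = frechet_derivative f (at y) (\<Sum>i\<in>UNIV. h $ i *s axis i 1)"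
    by (simp only: basis_expansion)
  also have "\<dots> = (\<Sum>i\<in>UNIV. h $ i * partial_deriv f i y)"
    by (simp add: sum scale partial_deriv_def scalar_mult_eq_scaleR)
  finally show ?thesis by (simp add: mult.commute)
qed

lemma has_real_derivative_along:
  fixes f :: "real^'n \<Rightarrow> real"
  assumes "f differentiable (at (x + a *\<^sub>R h))"
  shows "((\<lambda>a. f (x + a *\<^sub>R h)) has_real_derivative
           (\<Sum>i\<in>UNIV. partial_deriv f i (x + a *\<^sub>R h) * h $ i)) (at a)"
proof -
  let ?f' = "frechet_derivative f (at (x + a *\<^sub>R h))"
  have "((\<lambda>a. x + a *\<^sub>R h) has_derivative (\<lambda>b. b *\<^sub>R h)) (at a)"
    by (auto intro!: derivative_eq_intros)
  moreover have "(f has_derivative ?f') (at (x + a *\<^sub>R h))"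
    using assms by (simp add: frechet_derivative_works)
  ultimately have "((\<lambda>a. f (x + a *\<^sub>R h)) has_derivative (\<lambda>b. ?f' (b *\<^sub>R h))) (at a)"
    by (rule has_derivative_compose)
  moreover have "?f' (b *\<^sub>R h) = (\<Sum>i\<in>UNIV. partial_deriv f i (x + a *\<^sub>R h) * h $ i) * b" for b
    by (simp add: frechet_derivative_eq_sum_partial[OF assms] sum_distrib_right sum_distrib_left
          mult_ac)
  ultimately show ?thesis by (simp add: has_field_derivative_def)
qed

lemma has_real_derivative_along_axis:
  fixes f :: "real^'n \<Rightarrow> real"
  assumes "f differentiable (at (x + a *\<^sub>R axis i 1))"
  shows "((\<lambda>a. f (x + a *\<^sub>R axis i 1)) has_real_derivative
           partial_deriv f i (x + a *\<^sub>R axis i 1)) (at a)"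
proof -
  have "(\<Sum>k\<in>UNIV. partial_deriv f k y * axis i 1 $ k) = partial_deriv f i y" for y
    by (simp add: axis_def if_distrib cong: if_cong)
  with has_real_derivative_along[OF assms] show ?thesis by simp
qed

text \<open>The mean value theorem is applied twice: along axis i to the difference of f across a
  step h in axis j, then along axis j to the i-th partial derivative. Two displacements of length at
  most h explain the radius 2h.\<close>

lemma second_difference_eq_partial:
  fixes f :: "real^'n \<Rightarrow> real"
  assumes C2: "C_k_on_open 2 f S" and h: "h > 0" and S: "cball x (2 * h) \<subseteq> S"
  shows "\<exists>p\<in>cball x (2 * h).
    f (x + h *\<^sub>R axis i 1 + h *\<^sub>R axis j 1) - f (x + h *\<^sub>R axis i 1) - f (x + h *\<^sub>R axis j 1) + f x
      = h\<^sup>2 * partial_deriv (partial_deriv f i) j p"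
proof -
  have diff: "f differentiable (at y)" "partial_deriv f k differentiable (at y)" if "y \<in> S" for y k
    using C2 that by (simp_all add: numeral_2_eq_2)
  have mem: "x + a *\<^sub>R axis i 1 + b *\<^sub>R axis j 1 \<in> cball x (2 * h)"
    if "0 \<le> a" "a \<le> h" "0 \<le> b" "b \<le> h" for a b
  proof -
    have "norm (a *\<^sub>R axis i 1 + b *\<^sub>R axis j 1 :: real^'n) \<le> 2 * h"
      by (rule order_trans[OF norm_triangle_ineq]) (use that in simp)
    then show ?thesis by (metis add.assoc dist_add_cancel dist_0_norm mem_cball add.right_neutral)
  qed
  have mem0: "x + a *\<^sub>R axis i 1 \<in> S" if "0 \<le> a" "a \<le> h" for a
    using mem[of a 0] that h S by auto
  let ?\<phi> = "\<lambda>a. f (x + h *\<^sub>R axis j 1 + a *\<^sub>R axis i 1) - f (x + a *\<^sub>R axis i 1)"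
  have swap: "x + h *\<^sub>R axis j 1 + a *\<^sub>R axis i 1 = x + a *\<^sub>R axis i 1 + h *\<^sub>R axis j 1" for a
    by simp
  have "(?\<phi> has_real_derivative
          partial_deriv f i (x + h *\<^sub>R axis j 1 + a *\<^sub>R axis i 1)
            - partial_deriv f i (x + a *\<^sub>R axis i 1)) (at a)" if "0 \<le> a" "a \<le> h" for a
  proof (intro DERIV_diff has_real_derivative_along_axis diff)
    show "x + h *\<^sub>R axis j 1 + a *\<^sub>R axis i 1 \<in> S"
      unfolding swap using mem[of a h] that h S by auto
    show "x + a *\<^sub>R axis i 1 \<in> S" using that by (rule mem0)
  qed
  from MVT2[OF h this] obtain a where a: "0 < a" "a < h" and
    \<phi>: "?\<phi> h - ?\<phi> 0 = h * (partial_deriv f i (x + h *\<^sub>R axis j 1 + a *\<^sub>R axis i 1)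
            - partial_deriv f i (x + a *\<^sub>R axis i 1))" by auto
  let ?\<psi> = "\<lambda>b. partial_deriv f i (x + a *\<^sub>R axis i 1 + b *\<^sub>R axis j 1)"
  have "(?\<psi> has_real_derivative
          partial_deriv (partial_deriv f i) j (x + a *\<^sub>R axis i 1 + b *\<^sub>R axis j 1)) (at b)"
    if "0 \<le> b" "b \<le> h" for b
    using mem[of a b] a that S by (intro has_real_derivative_along_axis diff) auto
  from MVT2[OF h this] obtain b where b: "0 < b" "b < h" and
    \<psi>: "?\<psi> h - ?\<psi> 0
      = h * partial_deriv (partial_deriv f i) j (x + a *\<^sub>R axis i 1 + b *\<^sub>R axis j 1)" by auto
  let ?p = "x + a *\<^sub>R axis i 1 + b *\<^sub>R axis j 1"
  have "?\<phi> h - ?\<phi> 0 = h * (?\<psi> h - ?\<psi> 0)"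
    using \<phi> by (simp add: add_ac)
  also have "\<dots> = h\<^sup>2 * partial_deriv (partial_deriv f i) j ?p"
    unfolding \<psi> by (simp add: power2_eq_square)
  finally have "f (x + h *\<^sub>R axis i 1 + h *\<^sub>R axis j 1) - f (x + h *\<^sub>R axis i 1) - f (x + h *\<^sub>R axis j 1) + f x
      = h\<^sup>2 * partial_deriv (partial_deriv f i) j ?p"
    by (simp add: add_ac)
  with mem[of a b] a b show ?thesis by (intro bexI[of _ ?p]) auto
qed

text \<open>Schwarz's theorem. The second difference is symmetric in i and j, so both mixed
  derivatives take a common value at two points near x, and continuity carries the equality to
  x.\<close>

lemma partial_deriv_commute:
  fixes f :: "real^'n \<Rightarrow> real"
  assumes C2: "C_k_on_open 2 f S" and S: "open S" "x \<in> S"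
  shows "partial_deriv (partial_deriv f i) j x = partial_deriv (partial_deriv f j) i x"
proof (rule ccontr)
  let ?F = "\<lambda>i j. partial_deriv (partial_deriv f i) j"
  assume "?F i j x \<noteq> ?F j i x"
  \<comment> \<open>Half of the supposed gap: equal values cannot each be closer than this to their
    own limit.\<close>
  then have e: "\<bar>?F i j x - ?F j i x\<bar> / 2 > 0" (is "?e > 0") by simp
  have cont: "isCont (?F i j) x" for i j
    using C2 S by (simp add: numeral_2_eq_2 continuous_on_eq_continuous_at)
  from e cont obtain r1 where r1: "r1 > 0" "\<And>y. dist y x < r1 \<Longrightarrow> dist (?F i j y) (?F i j x) < ?e"
    unfolding continuous_at_eps_delta by blast
  from e cont obtain r2 where r2: "r2 > 0" "\<And>y. dist y x < r2 \<Longrightarrow> dist (?F j i y) (?F j i x) < ?e"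
    unfolding continuous_at_eps_delta by blast
  from S obtain r3 where r3: "r3 > 0" "cball x r3 \<subseteq> S" 
    using open_contains_cball by blast
  \<comment> \<open>The inner halving makes 2h strictly smaller than r1 and r2, as the open balls
    require; the closed ball only asks for 2h \<le> r3.\<close>
  define h where "h = min r3 (min r1 r2 / 2) / 2"
  have h: "h > 0" "2 * h \<le> r3" "2 * h < r1" "2 * h < r2"
    using r1(1) r2(1) r3(1) by (auto simp: h_def min_def)
  have sub: "cball x (2 * h) \<subseteq> S" using h(2) r3(2) by (meson order_trans subset_cball)
  obtain p where p: "p \<in> cball x (2 * h)" and
    p_eq: "f (x + h *\<^sub>R axis i 1 + h *\<^sub>R axis j 1) - f (x + h *\<^sub>R axis i 1) - f (x + h *\<^sub>R axis j 1) + f x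
      = h\<^sup>2 * ?F i j p"
    using second_difference_eq_partial[OF C2 h(1) sub] by blast
  obtain q where q: "q \<in> cball x (2 * h)" and
    q_eq: "f (x + h *\<^sub>R axis j 1 + h *\<^sub>R axis i 1) - f (x + h *\<^sub>R axis j 1) - f (x + h *\<^sub>R axis i 1) + f x
      = h\<^sup>2 * ?F j i q"
    using second_difference_eq_partial[OF C2 h(1) sub] by blast
  have swap: "x + h *\<^sub>R axis j 1 + h *\<^sub>R axis i 1 = x + h *\<^sub>R axis i 1 + h *\<^sub>R axis j 1"
    by (simp add: add_ac)
  have "h\<^sup>2 * ?F i j p = h\<^sup>2 * ?F j i q" using p_eq q_eq unfolding swap by linarith
  then have "?F i j p = ?F j i q" using h(1) by simp
  moreover have "dist (?F i j p) (?F i j x) < ?e" using p h by (intro r1(2)) (auto simp: dist_commute)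
  moreover have "dist (?F j i q) (?F j i x) < ?e" using q h by (intro r2(2)) (auto simp: dist_commute)
  ultimately show False by (simp add: dist_real_def abs_if split: if_splits)
qed

text \<open>The gradient is differentiable as a vector-valued map because its components are, so the
  Jacobian in \<open>hess\<close> can be read off entry by entry as iterated partial
  derivatives.\<close>

lemma hess_component:
  fixes f :: "real^'n \<Rightarrow> real"
  assumes "\<And>i. partial_deriv f i differentiable (at x)"
  shows "hess f x $ i $ j = partial_deriv (partial_deriv f i) j x"
proof -
  have d: "(partial_deriv f i has_derivative frechet_derivative (partial_deriv f i) (at x)) (at x)" for i
    using assms frechet_derivative_works by blast
  have "((\<lambda>y. \<chi> i. partial_deriv f i y) has_derivative
          (\<lambda>h. \<chi> i. frechet_derivative (partial_deriv f i) (at x) h)) (at x)"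
  proof (rule has_derivative_componentwise_within[THEN iffD2], rule ballI)
    fix b :: "real^'n" assume "b \<in> Basis"
    then obtain i where "b = axis i 1" by (auto simp: Basis_vec_def)
    then show "((\<lambda>y. (\<chi> i. partial_deriv f i y) \<bullet> b) has_derivative
        (\<lambda>h. (\<chi> i. frechet_derivative (partial_deriv f i) (at x) h) \<bullet> b)) (at x)"
      using d[of i] by (simp add: inner_axis)
  qed
  then have "frechet_derivative (grad f) (at x) =
      (\<lambda>h. \<chi> i. frechet_derivative (partial_deriv f i) (at x) h)"
    unfolding grad_def[abs_def] by (rule frechet_derivative_at[symmetric])
  then show ?thesis
    by (simp add: hess_def jacobian_def matrix_def partial_deriv_def)
qed

lemma transpose_hess:
  assumes "C_k_on_open 3 f S" "open S" "x \<in> S"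
  shows "transpose (hess f x) = hess f x"
proof -
  have diff: "f differentiable (at y)" "partial_deriv f i differentiable (at y)"
     "partial_deriv (partial_deriv f i) j differentiable (at y)" if "y \<in> S" for y i j
    using assms(1) that by (simp_all add: numeral_3_eq_3)
  \<comment> \<open>\<open>C_k_on_open\<close> records continuity only at its top order; continuity
    of the second partials is recovered here from their differentiability.\<close>
  have "C_k_on_open 2 f S"
    using diff assms(2)
    by (auto simp: numeral_2_eq_2 continuous_on_eq_continuous_at differentiable_imp_continuous_within)
  then have "partial_deriv (partial_deriv f i) j x = partial_deriv (partial_deriv f j) i x" for i j
    using assms(2,3) by (rule partial_deriv_commute)
  then show ?thesis
    by (simp add: vec_eq_iff transpose_def hess_component diff assms(3))
qed

section \<open>Taylor expansions along segments and their remainders\<close>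

text \<open>One-dimensional Maclaurin expansion of a \<mapsto> f(x + a h), with \<open>D m\<close>
  the m-th derivative along the segment. It will be applied to each partial derivative of f, to
  expand the gradient at the returned point.\<close>

lemma taylor_order2:
  fixes f :: "real^'n \<Rightarrow> real"
  assumes C2: "C_k_on_open 2 f S" and seg: "\<And>a. 0 \<le> a \<Longrightarrow> a \<le> 1 \<Longrightarrow> x + a *\<^sub>R h \<in> S"
  shows "\<exists>a. 0 < a \<and> a < 1 \<and> f (x + h) = f x + (\<Sum>i\<in>UNIV. partial_deriv f i x * h $ i)
    + (\<Sum>i\<in>UNIV. \<Sum>j\<in>UNIV. partial_deriv (partial_deriv f i) j (x + a *\<^sub>R h) * h $ j * h $ i) / 2"
proof -
  have diff: "f differentiable (at y)" "partial_deriv f i differentiable (at y)" if "y \<in> S" for y i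
    using C2 that by (simp_all add: numeral_2_eq_2)
  define D where "D m a = (if m = 0 then f (x + a *\<^sub>R h)
    else if m = 1 then (\<Sum>i\<in>UNIV. partial_deriv f i (x + a *\<^sub>R h) * h $ i)
    else (\<Sum>i\<in>UNIV. \<Sum>j\<in>UNIV. partial_deriv (partial_deriv f i) j (x + a *\<^sub>R h) * h $ j * h $ i))"
    for m :: nat and a
  have "\<exists>a>0. a < 1 \<and> (\<lambda>a. f (x + a *\<^sub>R h)) 1
      = (\<Sum>m<2. D m 0 / fact m * 1 ^ m) + D 2 a / fact 2 * 1 ^ 2"
  proof (rule Maclaurin)
    show "\<forall>m a. m < 2 \<and> 0 \<le> a \<and> a \<le> 1 \<longrightarrow> DERIV (D m) a :> D (Suc m) a"
    proof (intro allI impI)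
      fix m :: nat and a :: real assume "m < 2 \<and> 0 \<le> a \<and> a \<le> 1"
      then have m: "m = 0 \<or> m = 1" and y: "x + a *\<^sub>R h \<in> S" using seg by auto
      from m show "DERIV (D m) a :> D (Suc m) a"
      proof
        assume "m = 0"
        then show ?thesis using has_real_derivative_along[OF diff(1)[OF y]] by (simp add: D_def[abs_def])
      next
        assume "m = 1"
        moreover have "((\<lambda>a. \<Sum>i\<in>UNIV. partial_deriv f i (x + a *\<^sub>R h) * h $ i) has_real_derivative
            (\<Sum>i\<in>UNIV. (\<Sum>j\<in>UNIV. partial_deriv (partial_deriv f i) j (x + a *\<^sub>R h) * h $ j) * h $ i)) (at a)"
          by (intro DERIV_sum DERIV_cmult_right has_real_derivative_along diff y)
        ultimately show ?thesis by (simp add: D_def[abs_def] sum_distrib_right)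
      qed
    qed
  qed (auto simp: D_def)
  then obtain a where "0 < a" "a < 1" "f (x + h) = (\<Sum>m<2. D m 0 / fact m) + D 2 a / fact 2"
    by auto
  moreover have "(\<Sum>m<2. D m 0 / fact m) = f x + (\<Sum>i\<in>UNIV. partial_deriv f i x * h $ i)"
    by (simp add: numeral_2_eq_2 D_def)
  ultimately show ?thesis by (intro exI[of _ a]) (simp add: D_def)
qed

text \<open>The same argument one order higher, for f itself: the cubic decrease test calls for a
  cubic remainder.\<close>

lemma taylor_order3:
  fixes f :: "real^'n \<Rightarrow> real"
  assumes C3: "C_k_on_open 3 f S" and seg: "\<And>a. 0 \<le> a \<Longrightarrow> a \<le> 1 \<Longrightarrow> x + a *\<^sub>R h \<in> S"
  shows "\<exists>a. 0 < a \<and> a < 1 \<and> f (x + h) = f x + (\<Sum>i\<in>UNIV. partial_deriv f i x * h $ i)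
    + (\<Sum>i\<in>UNIV. \<Sum>j\<in>UNIV. partial_deriv (partial_deriv f i) j x * h $ j * h $ i) / 2
    + (\<Sum>i\<in>UNIV. \<Sum>j\<in>UNIV. \<Sum>k\<in>UNIV.
        partial_deriv (partial_deriv (partial_deriv f i) j) k (x + a *\<^sub>R h) * h $ k * h $ j * h $ i) / 6"
proof -
  have diff: "f differentiable (at y)" "partial_deriv f i differentiable (at y)"
     "partial_deriv (partial_deriv f i) j differentiable (at y)" if "y \<in> S" for y i j
    using C3 that by (simp_all add: numeral_3_eq_3)
  define D where "D m a = (if m = 0 then f (x + a *\<^sub>R h)
    else if m = 1 then (\<Sum>i\<in>UNIV. partial_deriv f i (x + a *\<^sub>R h) * h $ i)
    else if m = 2 then
      (\<Sum>i\<in>UNIV. \<Sum>j\<in>UNIV. partial_deriv (partial_deriv f i) j (x + a *\<^sub>R h) * h $ j * h $ i)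
    else (\<Sum>i\<in>UNIV. \<Sum>j\<in>UNIV. \<Sum>k\<in>UNIV.
      partial_deriv (partial_deriv (partial_deriv f i) j) k (x + a *\<^sub>R h) * h $ k * h $ j * h $ i))"
    for m :: nat and a
  have "\<exists>a>0. a < 1 \<and> (\<lambda>a. f (x + a *\<^sub>R h)) 1
      = (\<Sum>m<3. D m 0 / fact m * 1 ^ m) + D 3 a / fact 3 * 1 ^ 3"
  proof (rule Maclaurin)
    show "\<forall>m a. m < 3 \<and> 0 \<le> a \<and> a \<le> 1 \<longrightarrow> DERIV (D m) a :> D (Suc m) a"
    proof (intro allI impI)
      fix m :: nat and a :: real assume "m < 3 \<and> 0 \<le> a \<and> a \<le> 1"
      then consider "m = 0" | "m = 1" | "m = 2" by linarith
      moreover have y: "x + a *\<^sub>R h \<in> S" using seg \<open>m < 3 \<and> 0 \<le> a \<and> a \<le> 1\<close> by auto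
      ultimately show "DERIV (D m) a :> D (Suc m) a"
      proof cases
        case 1
        then show ?thesis using has_real_derivative_along[OF diff(1)[OF y]] by (simp add: D_def[abs_def])
      next
        case 2
        moreover have "((\<lambda>a. \<Sum>i\<in>UNIV. partial_deriv f i (x + a *\<^sub>R h) * h $ i) has_real_derivative
            (\<Sum>i\<in>UNIV. (\<Sum>j\<in>UNIV. partial_deriv (partial_deriv f i) j (x + a *\<^sub>R h) * h $ j) * h $ i)) (at a)"
          by (intro DERIV_sum DERIV_cmult_right has_real_derivative_along diff y)
        ultimately show ?thesis by (simp add: D_def[abs_def] sum_distrib_right)
      next
        case 3
        moreover have "((\<lambda>a. \<Sum>i\<in>UNIV. \<Sum>j\<in>UNIV. partial_deriv (partial_deriv f i) j (x + a *\<^sub>R h) * h $ j * h $ i)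
          has_real_derivative
            (\<Sum>i\<in>UNIV. \<Sum>j\<in>UNIV. (\<Sum>k\<in>UNIV. partial_deriv (partial_deriv (partial_deriv f i) j) k (x + a *\<^sub>R h)
              * h $ k) * h $ j * h $ i)) (at a)"
          by (intro DERIV_sum DERIV_cmult_right has_real_derivative_along diff y)
        ultimately show ?thesis by (simp add: D_def[abs_def] sum_distrib_right)
      qed
    qed
  qed (auto simp: D_def)
  then obtain a where "0 < a" "a < 1" "f (x + h) = (\<Sum>m<3. D m 0 / fact m) + D 3 a / fact 3"
    by auto
  moreover have "(\<Sum>m<3. D m 0 / fact m) = f x + (\<Sum>i\<in>UNIV. partial_deriv f i x * h $ i)
    + (\<Sum>i\<in>UNIV. \<Sum>j\<in>UNIV. partial_deriv (partial_deriv f i) j x * h $ j * h $ i) / 2"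
    by (simp add: numeral_3_eq_3 D_def numeral_2_eq_2)
  moreover have "fact 3 = (6::real)" by (simp add: fact_numeral)
  ultimately show ?thesis by (intro exI[of _ a]) (simp add: D_def)
qed

text \<open>The entrywise l1 norm of the third derivative tensor. It dominates the trilinear form
  crudely but is visibly continuous, so it is bounded on compact sets.\<close>

definition third_deriv_sum :: "(real^'n \<Rightarrow> real) \<Rightarrow> real^'n \<Rightarrow> real" where
  "third_deriv_sum f y =
     (\<Sum>i\<in>UNIV. \<Sum>j\<in>UNIV. \<Sum>k\<in>UNIV. \<bar>partial_deriv (partial_deriv (partial_deriv f i) j) k y\<bar>)"

lemma grad_inner: "grad f x \<bullet> h = (\<Sum>i\<in>UNIV. partial_deriv f i x * h $ i)"
  by (simp add: inner_vec_def grad_def)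

text \<open>The cubic upper model usually drawn from a Lipschitz Hessian. Balls are convex, so the
  intermediate point of the expansion stays where M bounds the third derivatives, and each component
  of h is at most its norm.\<close>

lemma taylor_upper_bound:
  fixes f :: "real^'n \<Rightarrow> real"
  assumes C3: "C_k_on_open 3 f S" and S: "cball x r \<subseteq> S" and h: "norm h \<le> r"
    and M: "\<And>y. y \<in> cball x r \<Longrightarrow> third_deriv_sum f y \<le> M"
  shows "f (x + h) \<le> f x + grad f x \<bullet> h + h \<bullet> (hess f x *v h) / 2 + M / 6 * norm h ^ 3"
proof -
  have seg: "x + a *\<^sub>R h \<in> cball x r" if "0 \<le> a" "a \<le> 1" for a
  proof -
    have "a * norm h \<le> 1 * norm h" using that by (intro mult_right_mono) auto
    then show ?thesis using h that by (simp add: dist_norm)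
  qed
  have segS: "x + a *\<^sub>R h \<in> S" if "0 \<le> a" "a \<le> 1" for a using seg[OF that] S by blast
  obtain a where a: "0 < a" "a < 1" and eq: "f (x + h) = f x + (\<Sum>i\<in>UNIV. partial_deriv f i x * h $ i)
    + (\<Sum>i\<in>UNIV. \<Sum>j\<in>UNIV. partial_deriv (partial_deriv f i) j x * h $ j * h $ i) / 2
    + (\<Sum>i\<in>UNIV. \<Sum>j\<in>UNIV. \<Sum>k\<in>UNIV.
        partial_deriv (partial_deriv (partial_deriv f i) j) k (x + a *\<^sub>R h) * h $ k * h $ j * h $ i) / 6"
    using taylor_order3[OF C3 segS] by blast
  let ?y = "x + a *\<^sub>R h"
  have "x \<in> S" using segS[of 0] by simp
  then have "hess f x $ i $ j = partial_deriv (partial_deriv f i) j x" for i j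
    using C3 by (intro hess_component) (simp add: numeral_3_eq_3)
  then have hess: "h \<bullet> (hess f x *v h)
      = (\<Sum>i\<in>UNIV. \<Sum>j\<in>UNIV. partial_deriv (partial_deriv f i) j x * h $ j * h $ i)"
    by (simp add: inner_vec_def matrix_vector_mult_def sum_distrib_left mult_ac)
  have "(\<Sum>i\<in>UNIV. \<Sum>j\<in>UNIV. \<Sum>k\<in>UNIV.
        partial_deriv (partial_deriv (partial_deriv f i) j) k ?y * h $ k * h $ j * h $ i)
      \<le> (\<Sum>i\<in>UNIV. \<Sum>j\<in>UNIV. \<Sum>k\<in>UNIV.
        \<bar>partial_deriv (partial_deriv (partial_deriv f i) j) k ?y\<bar> * norm h ^ 3)"
  proof (intro sum_mono)
    fix i j k
    let ?d = "partial_deriv (partial_deriv (partial_deriv f i) j) k ?y"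
    have "?d * h $ k * h $ j * h $ i \<le> \<bar>?d\<bar> * (\<bar>h $ k\<bar> * \<bar>h $ j\<bar> * \<bar>h $ i\<bar>)"
      by (rule order_trans[OF abs_ge_self]) (simp add: abs_mult mult_ac)
    also have "\<dots> \<le> \<bar>?d\<bar> * (norm h * norm h * norm h)"
      by (intro mult_left_mono mult_mono component_le_norm_cart mult_nonneg_nonneg) auto
    finally show "?d * h $ k * h $ j * h $ i \<le> \<bar>?d\<bar> * norm h ^ 3"
      by (simp add: power3_eq_cube)
  qed
  also have "\<dots> = third_deriv_sum f ?y * norm h ^ 3"
    by (simp add: third_deriv_sum_def sum_distrib_right)
  also have "\<dots> \<le> M * norm h ^ 3"
    using M[OF seg[of a]] a by (intro mult_right_mono) auto
  finally show ?thesis unfolding eq hess grad_inner by simp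
qed

text \<open>Each component has its own intermediate point, so the remainders are estimated one by
  one and then added; passing through the l1 norm produces the factor
  \<open>CARD('n)\<close>.\<close>

lemma grad_taylor_bound:
  fixes f :: "real^'n \<Rightarrow> real"
  assumes C3: "C_k_on_open 3 f S" and S: "cball x r \<subseteq> S" and h: "norm h \<le> r"
    and M: "\<And>y. y \<in> cball x r \<Longrightarrow> third_deriv_sum f y \<le> M"
  shows "norm (grad f (x + h) - grad f x - hess f x *v h) \<le> CARD('n) * (M / 2 * (norm h)\<^sup>2)"
proof -
  have seg: "x + a *\<^sub>R h \<in> cball x r" if "0 \<le> a" "a \<le> 1" for a
  proof -
    have "a * norm h \<le> 1 * norm h" using that by (intro mult_right_mono) auto
    then show ?thesis using h that by (simp add: dist_norm)
  qed
  have segS: "x + a *\<^sub>R h \<in> S" if "0 \<le> a" "a \<le> 1" for a using seg[OF that] S by blast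
  have "x \<in> S" using segS[of 0] by simp
  then have hess: "hess f x $ i $ j = partial_deriv (partial_deriv f i) j x" for i j
    using C3 by (intro hess_component) (simp add: numeral_3_eq_3)
  have "\<bar>(grad f (x + h) - grad f x - hess f x *v h) $ i\<bar> \<le> M / 2 * (norm h)\<^sup>2" for i
  proof -
    have "C_k_on_open 2 (partial_deriv f i) S" using C3 by (simp add: numeral_3_eq_3 numeral_2_eq_2)
    from taylor_order2[OF this segS] obtain a where a: "0 < a" "a < 1"
      and eq: "partial_deriv f i (x + h) = partial_deriv f i x
        + (\<Sum>j\<in>UNIV. partial_deriv (partial_deriv f i) j x * h $ j)
        + (\<Sum>j\<in>UNIV. \<Sum>k\<in>UNIV. partial_deriv (partial_deriv (partial_deriv f i) j) k (x + a *\<^sub>R h)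
            * h $ k * h $ j) / 2" by blast
    let ?y = "x + a *\<^sub>R h"
    have "\<bar>\<Sum>j\<in>UNIV. \<Sum>k\<in>UNIV. partial_deriv (partial_deriv (partial_deriv f i) j) k ?y * h $ k * h $ j\<bar>
      \<le> (\<Sum>j\<in>UNIV. \<Sum>k\<in>UNIV. \<bar>partial_deriv (partial_deriv (partial_deriv f i) j) k ?y\<bar> * (norm h)\<^sup>2)"
    proof (intro order_trans[OF sum_abs] sum_mono)
      fix j k
      let ?d = "partial_deriv (partial_deriv (partial_deriv f i) j) k ?y"
      have "\<bar>?d * h $ k * h $ j\<bar> = \<bar>?d\<bar> * (\<bar>h $ k\<bar> * \<bar>h $ j\<bar>)" by (simp add: abs_mult)
      also have "\<dots> \<le> \<bar>?d\<bar> * (norm h * norm h)"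
        by (intro mult_left_mono mult_mono component_le_norm_cart) auto
      finally show "\<bar>?d * h $ k * h $ j\<bar> \<le> \<bar>?d\<bar> * (norm h)\<^sup>2" by (simp add: power2_eq_square)
    qed
    also have "\<dots> = (\<Sum>j\<in>UNIV. \<Sum>k\<in>UNIV. \<bar>partial_deriv (partial_deriv (partial_deriv f i) j) k ?y\<bar>) * (norm h)\<^sup>2"
      by (simp add: sum_distrib_right)
    \<comment> \<open>The double sum for the fixed index i is one slice of the nonnegative triple
      sum.\<close>
    also have "\<dots> \<le> third_deriv_sum f ?y * (norm h)\<^sup>2"
      unfolding third_deriv_sum_def
      by (intro mult_right_mono member_le_sum[of i UNIV "\<lambda>i. \<Sum>j\<in>UNIV. \<Sum>k\<in>UNIV. \<bar>_ i j k\<bar>"])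
         (auto intro!: sum_nonneg)
    also have "\<dots> \<le> M * (norm h)\<^sup>2"
      using M[OF seg[of a]] a by (intro mult_right_mono) auto
    finally show ?thesis
      by (simp add: grad_def eq matrix_vector_mult_def hess)
  qed
  then have "(\<Sum>i\<in>UNIV. \<bar>(grad f (x + h) - grad f x - hess f x *v h) $ i\<bar>)
      \<le> CARD('n) * (M / 2 * (norm h)\<^sup>2)"
    by (intro sum_bounded_above[of UNIV, simplified])
  with norm_le_l1_cart show ?thesis by (rule order_trans)
qed

section \<open>The affine scaling\<close>

lemma diag_mult_vec_component: "(diag a *v y) $ i = a $ i * y $ i"
  by (simp add: diag_def matrix_vector_mult_def if_distrib[of "\<lambda>z. z * _"] cong: if_cong)

lemma diag_mult_diag: "diag a ** diag b = diag (\<chi> i. a $ i * b $ i)"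
  by (simp add: vec_eq_iff diag_def matrix_matrix_mult_def if_distrib[of "\<lambda>z. z * _"] cong: if_cong)

lemma transpose_diag: "transpose (diag a) = diag a"
  by (auto simp: vec_eq_iff diag_def transpose_def)

lemma transpose_D_inv: "transpose (D_inv f l u x) = D_inv f l u x"
  by (simp add: D_inv_def transpose_diag)

text \<open>The sign in \<open>Jv\<close> follows the sign of the gradient component, so the
  products are absolute values or 0. Hence \<open>C_bar\<close> is positive semidefinite and no
  larger than the gradient, the two facts about it that the analysis rests on.\<close>

lemma C_bar_eq_diag:
  "C_bar f l u x = diag (\<chi> i. if grad f x $ i \<ge> 0 \<and> l $ i > - \<infinity> \<or> grad f x $ i < 0 \<and> u $ i < \<infinity>
     then \<bar>grad f x $ i\<bar> else 0)"
  unfolding C_bar_def Jv_def diag_mult_diag by (rule arg_cong[of _ _ diag]) (auto simp: vec_eq_iff)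

lemma transpose_B_bar:
  fixes f :: "real^'n \<Rightarrow> real"
  assumes "transpose (hess f x) = hess f x"
  shows "transpose (B_bar f l u x) = B_bar f l u x"
proof -
  have "transpose (A + B) = transpose A + transpose B" for A B :: "real^'n^'n"
    by (simp add: vec_eq_iff transpose_def)
  then show ?thesis
    by (simp add: B_bar_def matrix_transpose_mul transpose_D_inv assms C_bar_eq_diag transpose_diag
          matrix_mul_assoc)
qed

lemma inner_D_inv: "y \<bullet> (D_inv f l u x *v z) = (D_inv f l u x *v y) \<bullet> z"
  by (simp add: symmetric_matrix_inner[OF transpose_D_inv] inner_commute)

lemma B_bar_mult_vec:
  "B_bar f l u x *v z = D_inv f l u x *v (hess f x *v (D_inv f l u x *v z)) + C_bar f l u x *v z"
  by (simp add: B_bar_def matrix_vector_mult_add_rdistrib matrix_vector_mul_assoc matrix_mul_assoc)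

lemma B_bar_quadratic_form:
  "z \<bullet> (B_bar f l u x *v z) =
     (D_inv f l u x *v z) \<bullet> (hess f x *v (D_inv f l u x *v z)) + z \<bullet> (C_bar f l u x *v z)"
  by (simp add: B_bar_mult_vec inner_add_right inner_D_inv)

lemma C_bar_quadratic_form_nonneg: "z \<bullet> (C_bar f l u x *v z) \<ge> 0"
proof -
  have "0 \<le> z $ i * (C_bar f l u x *v z) $ i" for i
    by (simp add: C_bar_eq_diag diag_mult_vec_component mult.left_commute[of "z $ i"])
  then show ?thesis by (simp add: inner_vec_def sum_nonneg)
qed

lemma norm_C_bar_mult_le: "norm (C_bar f l u x *v z) \<le> norm (grad f x) * norm z"
proof -
  have "norm (C_bar f l u x *v z) \<le> norm (norm (grad f x) *\<^sub>R z)"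
  proof (rule norm_le_componentwise_cart)
    fix i
    have "\<bar>(C_bar f l u x *v z) $ i\<bar> \<le> \<bar>grad f x $ i\<bar> * \<bar>z $ i\<bar>"
      by (auto simp: C_bar_eq_diag diag_mult_vec_component abs_mult)
    also have "\<dots> \<le> norm (grad f x) * \<bar>z $ i\<bar>"
      by (intro mult_right_mono component_le_norm_cart) simp
    finally show "norm ((C_bar f l u x *v z) $ i) \<le> norm ((norm (grad f x) *\<^sub>R z) $ i)"
      by (simp add: abs_mult)
  qed
  then show ?thesis by simp
qed

text \<open>Uniform data around X: a margin r to the boundary and a bound M on third derivatives
  within that margin. The normalisation r \<le> 1 matches \<open>scaling_v\<close>, which has
  modulus 1 at components whose relevant bound is infinite.\<close>

locale interior_region =
  fixes f :: "real^'n \<Rightarrow> real" and l u :: "ereal^'n" and X S :: "(real^'n) set" and r M :: real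
  assumes r: "0 < r" "r \<le> 1"
    and open_S: "open S" and C3: "C_k_on_open 3 f S"
    and cball_S: "\<And>x. x \<in> X \<Longrightarrow> cball x r \<subseteq> S"
    and cball_feasible: "\<And>x. x \<in> X \<Longrightarrow> cball x r \<subseteq> strictly_feasible l u"
    and M_nonneg: "0 \<le> M"
    and third_deriv_le: "\<And>x y. x \<in> X \<Longrightarrow> y \<in> cball x r \<Longrightarrow> third_deriv_sum f y \<le> M"
begin

lemma distance_to_bounds:
  assumes "x \<in> X"
  shows "l $ i < ereal (x $ i - r)" "ereal (x $ i + r) < u $ i"
proof -
  have "x + r *\<^sub>R axis i 1 \<in> cball x r" "x - r *\<^sub>R axis i 1 \<in> cball x r"
    using r by (auto simp: dist_norm)
  then have "x + r *\<^sub>R axis i 1 \<in> strictly_feasible l u" "x - r *\<^sub>R axis i 1 \<in> strictly_feasible l u"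
    using cball_feasible[OF assms] by auto
  then show "l $ i < ereal (x $ i - r)" "ereal (x $ i + r) < u $ i"
    by (auto simp: strictly_feasible_def axis_def dest!: spec[of _ i])
qed

lemma scaling_v_ge:
  assumes "x \<in> X"
  shows "r \<le> \<bar>scaling_v f l u x $ i\<bar>"
  using distance_to_bounds[OF assms, of i] r
  by (cases "l $ i"; cases "u $ i") (auto simp: scaling_v_def)

text \<open>The scaling is bounded away from zero on X; this is what converts estimates of scaled
  quantities back into estimates of the gradient and the Hessian.\<close>

lemma norm_D_inv_mult_ge:
  assumes "x \<in> X"
  shows "sqrt r * norm y \<le> norm (D_inv f l u x *v y)"
proof -
  have "norm (sqrt r *\<^sub>R y) \<le> norm (D_inv f l u x *v y)"
  proof (rule norm_le_componentwise_cart)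
    fix i
    have "sqrt r * \<bar>y $ i\<bar> \<le> sqrt \<bar>scaling_v f l u x $ i\<bar> * \<bar>y $ i\<bar>"
      using scaling_v_ge[OF assms] by (intro mult_right_mono) auto
    then show "norm ((sqrt r *\<^sub>R y) $ i) \<le> norm ((D_inv f l u x *v y) $ i)"
      using r by (simp add: D_inv_def diag_mult_vec_component abs_mult)
  qed
  then show ?thesis using r by simp
qed

lemma hess_symmetric: "x \<in> X \<Longrightarrow> transpose (hess f x) = hess f x"
  using cball_S[of x] r by (intro transpose_hess[OF C3 open_S]) auto

text \<open>For each moving coordinate, one of the two quotients refers to the bound towards which
  it moves, and that bound is more than r away. With no moving coordinate the infimum is
  \<infinity>.\<close>

lemma ereal_le_alpha_max:
  assumes "x \<in> X" "a * norm d \<le> r"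
  shows "ereal a \<le> alpha_max l u x d"
  unfolding alpha_max_def
proof (rule INF_greatest)
  fix i assume "i \<in> {i. d $ i \<noteq> 0}"
  then have di: "d $ i \<noteq> 0" by simp
  have "a * \<bar>d $ i\<bar> \<le> r"
  proof (cases "a \<ge> 0")
    case True
    have "a * \<bar>d $ i\<bar> \<le> a * norm d"
      using True by (intro mult_left_mono component_le_norm_cart)
    then show ?thesis using assms(2) by simp
  next
    case False
    then show ?thesis using r by (smt (verit) mult_nonpos_nonneg abs_ge_zero)
  qed
  note ad = this
  note b = distance_to_bounds[OF assms(1), of i]
  show "ereal a \<le> max ((l $ i - ereal (x $ i)) / ereal (d $ i)) ((u $ i - ereal (x $ i)) / ereal (d $ i))"
  proof (cases "d $ i > 0")
    case True
    then have "ereal a \<le> (u $ i - ereal (x $ i)) / ereal (d $ i)"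
      using b ad by (cases "u $ i") (auto simp: field_simps)
    then show ?thesis by (simp add: le_max_iff_disj)
  next
    case False
    then have "d $ i < 0" using di by simp
    then have "ereal a \<le> (l $ i - ereal (x $ i)) / ereal (d $ i)"
      using b ad by (cases "l $ i") (auto simp: field_simps)
    then show ?thesis by (simp add: le_max_iff_disj)
  qed
qed

text \<open>\<open>real_of_ereal\<close> sends infinite values to 0, so the minimum must first be
  enclosed between two reals before it can be compared as a real number.\<close>

lemma real_min_alpha_max:
  assumes "x \<in> X" "a * norm d \<le> r" "0 < a" "a \<le> 1"
  shows "a \<le> real_of_ereal (min 1 (alpha_max l u x d))" "real_of_ereal (min 1 (alpha_max l u x d)) \<le> 1"
proof -
  have "ereal a \<le> min 1 (alpha_max l u x d)"
    using ereal_le_alpha_max[OF assms(1,2)] assms(4) by simp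
  moreover have "min 1 (alpha_max l u x d) \<le> ereal 1" by (simp add: one_ereal_def[symmetric])
  ultimately show "a \<le> real_of_ereal (min 1 (alpha_max l u x d))"
      "real_of_ereal (min 1 (alpha_max l u x d)) \<le> 1"
    by (cases "min 1 (alpha_max l u x d)"; simp)+
qed

text \<open>Along both kinds of direction the quadratic model decreases by the curvature term alone:
  as \<open>a \<le> 1\<close>, the contribution of \<open>\<theta> - \<delta>\<close> in the linear term outweighs the one in the
  quadratic term.\<close>

lemma model_decrease:
  assumes opt: "\<theta> \<ge> \<delta>" "s \<bullet> s + t\<^sup>2 = 1"
      "B_bar f l u x *v s + t *\<^sub>R g_bar f l u x = - \<theta> *\<^sub>R s"
      "g_bar f l u x \<bullet> s = (\<delta> - \<theta>) * t"
    and a: "0 < a" "a \<le> 1" and not_stop: "\<not> stops p t" and \<nu>: "par_nu p > 0"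
  defines "d \<equiv> d_bar f l u p x s t"
  shows "a * (g_bar f l u x \<bullet> d) + a\<^sup>2 / 2 * (d \<bullet> (B_bar f l u x *v d)) \<le> - (a\<^sup>2 / 2 * \<theta> * (norm d)\<^sup>2)"
proof -
  let ?g = "g_bar f l u x" and ?B = "B_bar f l u x"
  have Bs: "?B *v s = - \<theta> *\<^sub>R s - t *\<^sub>R ?g" using opt(3) by (simp add: eq_diff_eq)
  have sBs: "s \<bullet> (?B *v s) = - \<theta> * (s \<bullet> s) + t\<^sup>2 * (\<theta> - \<delta>)"
  proof -
    have sg: "s \<bullet> ?g = (\<delta> - \<theta>) * t" using opt(4) by (simp add: inner_commute)
    have "s \<bullet> (?B *v s) = - \<theta> * (s \<bullet> s) - t * (s \<bullet> ?g)" by (simp add: Bs inner_diff_right)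
    then show ?thesis unfolding sg by (simp add: power2_eq_square algebra_simps)
  qed
  show ?thesis
  proof (cases "\<bar>t\<bar> \<ge> par_nu p")
    case True
    then have t: "t \<noteq> 0" using \<nu> by auto
    have d: "d = (1 / t) *\<^sub>R s" using True not_stop by (simp add: d_def d_bar_def)
    have gd: "?g \<bullet> d = \<delta> - \<theta>" using opt(4) t by (simp add: d)
    have nd: "(norm d)\<^sup>2 = (s \<bullet> s) / t\<^sup>2"
      by (simp add: d power2_norm_eq_inner[symmetric] power_divide)
    have "d \<bullet> (?B *v d) = (s \<bullet> (?B *v s)) / t\<^sup>2"
      by (simp add: d matrix_vector_mult_scaleR power2_eq_square)
    also have "\<dots> = - \<theta> * (norm d)\<^sup>2 + (\<theta> - \<delta>)"
      using t by (simp add: sBs nd field_simps)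
    finally have dBd: "d \<bullet> (?B *v d) = - \<theta> * (norm d)\<^sup>2 + (\<theta> - \<delta>)" .
    have "a\<^sup>2 / 2 \<le> a" using a by (simp add: power2_eq_square)
    then have "a\<^sup>2 / 2 * (\<theta> - \<delta>) \<le> a * (\<theta> - \<delta>)" using opt(1) by (intro mult_right_mono) auto
    then show ?thesis unfolding gd dBd by (simp add: algebra_simps add_divide_distrib diff_divide_distrib)
  next
    case False
    then have d: "d = (if - (?g \<bullet> s) \<ge> 0 then s else - s)" using not_stop by (simp add: d_def d_bar_def)
    have nd: "(norm d)\<^sup>2 = s \<bullet> s" by (simp add: d power2_norm_eq_inner)
    \<comment> \<open>The sign rule of \<open>d_bar\<close> makes the linear term minus a modulus,
      with factor |t|, whereas the quadratic term carries t^2; the former wins because |t| \<le>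
      1.\<close>
    have gd: "?g \<bullet> d = - (\<bar>t\<bar> * (\<theta> - \<delta>))"
    proof -
      have "?g \<bullet> d = - \<bar>?g \<bullet> s\<bar>" by (auto simp: d)
      also have "\<bar>?g \<bullet> s\<bar> = \<bar>t\<bar> * (\<theta> - \<delta>)" using opt(1) by (simp add: opt(4) abs_mult)
      finally show ?thesis .
    qed
    have "?B *v (- s) = - (?B *v s)"
      using matrix_vector_mult_scaleR[of ?B "- 1" s] by simp
    then have dBd: "d \<bullet> (?B *v d) = - \<theta> * (norm d)\<^sup>2 + t\<^sup>2 * (\<theta> - \<delta>)"
      by (simp add: d sBs power2_norm_eq_inner)
    have "t\<^sup>2 \<le> 1" using opt(2) by (smt (verit) inner_ge_zero)
    then have t1: "\<bar>t\<bar> \<le> 1" by (simp add: abs_square_le_1)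
    have "a\<^sup>2 / 2 * t\<^sup>2 \<le> a * \<bar>t\<bar>"
    proof -
      have "a\<^sup>2 * t\<^sup>2 = (a * \<bar>t\<bar>) * (a * \<bar>t\<bar>)" by (simp add: power2_eq_square algebra_simps)
      also have "\<dots> \<le> (a * \<bar>t\<bar>) * 1" using a t1 by (intro mult_left_mono mult_le_one) auto
      finally show ?thesis using a by (smt (verit) abs_ge_zero mult_nonneg_nonneg times_divide_eq_left field_sum_of_halves)
    qed
    then have "a\<^sup>2 / 2 * t\<^sup>2 * (\<theta> - \<delta>) \<le> a * \<bar>t\<bar> * (\<theta> - \<delta>)" using opt(1) by (intro mult_right_mono) auto
    then show ?thesis unfolding gd dBd by (simp add: algebra_simps add_divide_distrib diff_divide_distrib)
  qed
qed

text \<open>With y = a * norm d, the model gains \<theta> y^2 / 2, while the Taylor remainder and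
  the demanded decrease together cost (M \<gamma>D^3 + \<gamma>) y^3 / 6; \<open>step\<close> says
  exactly that the gain suffices, as \<theta> \<ge> \<delta>. The assumption \<open>near\<close>
  keeps the trial point in the ball on which M is valid.\<close>

lemma sufficient_decrease:
  assumes x: "x \<in> X"
    and opt: "\<theta> \<ge> \<delta>" "s \<bullet> s + t\<^sup>2 = 1"
      "B_bar f l u x *v s + t *\<^sub>R g_bar f l u x = - \<theta> *\<^sub>R s"
      "g_bar f l u x \<bullet> s = (\<delta> - \<theta>) * t"
    and a: "0 < a" "a \<le> 1" and not_stop: "\<not> stops p t" and \<nu>: "par_nu p > 0"
    and \<gamma>: "\<gamma> > 0" and \<gamma>D: "\<gamma>D > 0" "opnorm (D_inv f l u x) \<le> \<gamma>D"
  defines "d \<equiv> d_bar f l u p x s t"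
  assumes step: "a * norm d \<le> 3 * \<delta> / (M * \<gamma>D ^ 3 + \<gamma>)" and near: "a * norm d \<le> r / \<gamma>D"
  shows "f (x + a *\<^sub>R direction f l u p x s t) - f x \<le> - (\<gamma> / 6) * a ^ 3 * norm d ^ 3"
proof -
  let ?g = "g_bar f l u x" and ?B = "B_bar f l u x" and ?D = "D_inv f l u x"
  have dir: "direction f l u p x s t = ?D *v d" by (simp add: direction_def d_def)
  have Dd: "norm (?D *v d) \<le> \<gamma>D * norm d"
    by (rule order_trans[OF norm_matrix_vector_mult_le]) (use \<gamma>D in \<open>intro mult_right_mono, auto\<close>)
  have aDd: "norm (a *\<^sub>R (?D *v d)) \<le> \<gamma>D * (a * norm d)"
    using mult_left_mono[OF Dd, of a] a by (simp add: mult_ac)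
  also have "\<dots> \<le> r" using near \<gamma>D by (simp add: field_simps)
  finally have le_r: "norm (a *\<^sub>R (?D *v d)) \<le> r" .
  have P: "M * \<gamma>D ^ 3 + \<gamma> > 0" using M_nonneg \<gamma> \<gamma>D(1) by (intro add_nonneg_pos mult_nonneg_nonneg) auto
  have "f (x + a *\<^sub>R (?D *v d)) \<le> f x + grad f x \<bullet> (a *\<^sub>R (?D *v d))
      + (a *\<^sub>R (?D *v d)) \<bullet> (hess f x *v (a *\<^sub>R (?D *v d))) / 2 + M / 6 * norm (a *\<^sub>R (?D *v d)) ^ 3"
    by (rule taylor_upper_bound[OF C3 cball_S[OF x] le_r third_deriv_le[OF x]])
  also have "grad f x \<bullet> (a *\<^sub>R (?D *v d)) = a * (?g \<bullet> d)"
    by (simp add: g_bar_def inner_D_inv)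
  also have "(a *\<^sub>R (?D *v d)) \<bullet> (hess f x *v (a *\<^sub>R (?D *v d)))
      = a\<^sup>2 * (d \<bullet> (?B *v d) - d \<bullet> (C_bar f l u x *v d))"
    by (simp add: B_bar_quadratic_form matrix_vector_mult_scaleR power2_eq_square)
  \<comment> \<open>Replacing the scaled Hessian by \<open>B_bar\<close> can only raise the bound,
    since \<open>C_bar\<close> is positive semidefinite.\<close>
  also have "a\<^sup>2 * (d \<bullet> (?B *v d) - d \<bullet> (C_bar f l u x *v d)) / 2 \<le> a\<^sup>2 / 2 * (d \<bullet> (?B *v d))"
    using mult_nonneg_nonneg[OF zero_le_power2[of a] C_bar_quadratic_form_nonneg[of d f l u x]]
    by (simp add: algebra_simps)
  also have "M / 6 * norm (a *\<^sub>R (?D *v d)) ^ 3 \<le> M / 6 * (\<gamma>D * (a * norm d)) ^ 3"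
    using M_nonneg aDd by (intro mult_left_mono power_mono) auto
  finally have "f (x + a *\<^sub>R (?D *v d)) - f x
      \<le> (a * (?g \<bullet> d) + a\<^sup>2 / 2 * (d \<bullet> (?B *v d))) + M / 6 * (\<gamma>D * (a * norm d)) ^ 3"
    by simp
  also have "\<dots> \<le> - (a\<^sup>2 / 2 * \<theta> * (norm d)\<^sup>2) + M / 6 * (\<gamma>D * (a * norm d)) ^ 3"
    using model_decrease[OF opt a not_stop \<nu>] by (simp add: d_def)
  also have "\<dots> \<le> - (\<gamma> / 6) * a ^ 3 * norm d ^ 3"
  proof -
    let ?y = "a * norm d"
    have "(M * \<gamma>D ^ 3 + \<gamma>) * ?y \<le> 3 * \<theta>"
      using step P opt(1) by (simp add: field_simps)
    then have "(M * \<gamma>D ^ 3 + \<gamma>) * ?y * ?y\<^sup>2 \<le> 3 * \<theta> * ?y\<^sup>2"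
      by (intro mult_right_mono) auto
    then show ?thesis by (simp add: power2_eq_square power3_eq_cube algebra_simps)
  qed
  finally show ?thesis unfolding dir .
qed

end

section \<open>Complexity of a run\<close>

text \<open>The first condition in \<open>small\<close> makes every step short enough for the
  decrease test also short enough to stay in the ball of radius r. The second gives \<Delta> \<le>
  1/2, which matches \<nu> < 1/2 in the lower bound on the direction when |t| < \<nu>.\<close>

locale small_tolerance_run = interior_region f l u X S r M
  for f :: "real^'n \<Rightarrow> real" and l u :: "ereal^'n" and X S :: "(real^'n) set" and r M :: real +
  fixes \<nu> \<gamma> \<beta> \<tau> \<gamma>D L \<epsilon> :: real and p :: sobasip_params
    and x s :: "nat \<Rightarrow> real^'n" and t :: "nat \<Rightarrow> real"
  assumes params: "0 < \<nu>" "\<nu> < 1/2" "0 < \<gamma>" "0 < \<beta>" "\<beta> < 1" "0 < \<tau>" "\<tau> < 1" "0 < \<gamma>D" "0 < L" "0 < \<epsilon>"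
    and p: "p = \<lparr>par_nu = \<nu>, par_gamma = \<gamma>, par_beta = \<beta>, par_tau = \<tau>,
            par_Delta = 2 * sqrt \<epsilon> / L, par_delta = sqrt \<epsilon>\<rparr>"
    and run: "sobasip_run f l u p x s t"
    and iterates: "\<And>k. k \<in> iterate_indices f l u p x s t \<Longrightarrow> x k \<in> X \<and> opnorm (D_inv f l u (x k)) \<le> \<gamma>D"
    and bdd_below: "bdd_below (f ` feasible l u)"
    and small: "3 * sqrt \<epsilon> / (M * \<gamma>D ^ 3 + \<gamma>) \<le> r / \<gamma>D" "2 * sqrt \<epsilon> / L \<le> 1/2"
begin

abbreviation (input) "P \<equiv> M * \<gamma>D ^ 3 + \<gamma>"
abbreviation (input) "reached k \<equiv> reaches f l u p x s t k"
abbreviation (input) "dbar k \<equiv> d_bar f l u p (x k) (s k) (t k)"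
abbreviation (input) "trial k j \<equiv> alpha_trial f l u p (x k) (s k) (t k) j"
abbreviation (input) "accepted k j \<equiv> accepts f l u p (x k) (s k) (t k) j"
abbreviation (input) "index k \<equiv> search_index f l u p (x k) (s k) (t k)"

lemma P_pos: "P > 0"
  using M_nonneg params by (intro add_nonneg_pos mult_nonneg_nonneg) auto

lemma reached_iterate: "reached k \<Longrightarrow> x k \<in> X" "reached k \<Longrightarrow> opnorm (D_inv f l u (x k)) \<le> \<gamma>D"
  using iterates by (auto simp: iterate_indices_def)

lemma optimality:
  assumes "reached k"
  obtains \<theta> where "\<theta> \<ge> sqrt \<epsilon>" "s k \<bullet> s k + (t k)\<^sup>2 = 1"
    "B_bar f l u (x k) *v s k + t k *\<^sub>R g_bar f l u (x k) = - \<theta> *\<^sub>R s k"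
    "g_bar f l u (x k) \<bullet> s k = (sqrt \<epsilon> - \<theta>) * t k"
    "\<And>z. z \<bullet> (B_bar f l u (x k) *v z) \<ge> - \<theta> * (z \<bullet> z)"
proof -
  have "subproblem_solution f l u (sqrt \<epsilon>) (x k) (s k) (t k)"
    using run assms by (simp add: sobasip_run_def p)
  from subproblem_solution_optimality[OF this transpose_B_bar[OF hess_symmetric[OF reached_iterate(1)[OF assms]]]]
  show thesis using that params by auto
qed

section \<open>Lengths of directions and initial step sizes\<close>

text \<open>Not stopping means t^2 (1 + \<Delta>^2) \<le> 1 = s \<bullet> s + t^2, that is \<Delta>
  |t| \<le> norm s, so s / t has norm at least \<Delta>; the truncation |t| \<ge> \<nu> gives the
  upper bound. For |t| < \<nu> the vector s alone has norm between 1/2 and 1.\<close>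

lemma norm_d_bar_bounds:
  assumes "reached k" "\<not> stops p (t k)"
  shows "2 * sqrt \<epsilon> / L \<le> norm (dbar k)" "norm (dbar k) \<le> 1 / \<nu>"
proof -
  let ?\<Delta> = "2 * sqrt \<epsilon> / L"
  have one: "s k \<bullet> s k + (t k)\<^sup>2 = 1" using optimality[OF assms(1)] by blast
  have ss: "s k \<bullet> s k \<le> 1" using one by (smt (verit) zero_le_power2)
  have \<Delta>: "0 \<le> ?\<Delta>" using params by simp
  have pos: "1 + ?\<Delta>\<^sup>2 > 0" by (smt (verit) zero_le_power2)
  have "\<bar>t k\<bar> \<le> sqrt (1 / (1 + ?\<Delta>\<^sup>2))" using assms(2) by (simp add: stops_def p)
  then have "\<bar>t k\<bar>\<^sup>2 \<le> (sqrt (1 / (1 + ?\<Delta>\<^sup>2)))\<^sup>2" by (intro power_mono) auto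
  then have "(t k)\<^sup>2 \<le> 1 / (1 + ?\<Delta>\<^sup>2)" using pos by simp
  then have "(t k)\<^sup>2 * (1 + ?\<Delta>\<^sup>2) \<le> 1" using pos by (simp only: pos_le_divide_eq)
  then have t\<Delta>: "?\<Delta>\<^sup>2 * (t k)\<^sup>2 \<le> s k \<bullet> s k" using one by (simp add: algebra_simps)
  have "?\<Delta> \<le> norm (dbar k) \<and> norm (dbar k) \<le> 1 / \<nu>"
  proof (cases "\<bar>t k\<bar> \<ge> \<nu>")
    case True
    then have tk: "t k \<noteq> 0" using params by auto
    have nd: "(norm (dbar k))\<^sup>2 = (s k \<bullet> s k) / (t k)\<^sup>2"
      using True by (simp add: d_bar_def p power2_norm_eq_inner[symmetric] power_divide)
    have "?\<Delta>\<^sup>2 \<le> (norm (dbar k))\<^sup>2"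
      unfolding nd using t\<Delta> tk by (simp add: pos_le_divide_eq)
    moreover have "(norm (dbar k))\<^sup>2 \<le> (1 / \<nu>)\<^sup>2"
    proof -
      have "\<nu>\<^sup>2 \<le> (t k)\<^sup>2" using True params by (metis abs_le_square_iff abs_of_pos)
      then have "(s k \<bullet> s k) / (t k)\<^sup>2 \<le> 1 / \<nu>\<^sup>2" using ss params by (intro frac_le) auto
      then show ?thesis unfolding nd by (simp add: power_divide)
    qed
    ultimately show ?thesis using params by (intro conjI) (rule power2_le_imp_le; simp)+
  next
    case False
    then have nd: "(norm (dbar k))\<^sup>2 = s k \<bullet> s k"
      using assms(2) by (simp add: d_bar_def p power2_norm_eq_inner)
    have "(t k)\<^sup>2 \<le> (1/2)\<^sup>2" using False params by (intro abs_le_square_iff[THEN iffD1]) auto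
    then have "(1/2)\<^sup>2 \<le> (norm (dbar k))\<^sup>2" using one unfolding nd by (simp add: power2_eq_square)
    then have "1/2 \<le> norm (dbar k)" by (rule power2_le_imp_le) simp
    moreover have "norm (dbar k) \<le> 1" by (rule power2_le_imp_le) (use ss nd in simp_all)
    moreover have "1 \<le> 1 / \<nu>" using params by simp
    ultimately show ?thesis using small by linarith
  qed
  then show "?\<Delta> \<le> norm (dbar k)" "norm (dbar k) \<le> 1 / \<nu>" by auto
qed

lemma trial_eq: "trial k j = \<beta> ^ j * trial k 0"
  by (simp add: alpha_trial_def p)

text \<open>The unscaled direction is no longer than \<gamma>D / \<nu>, so r \<nu> / \<gamma>D times
  it moves at most r. This provides a uniform lower bound on the initial step sizes.\<close>

lemma trial_0_bounds:
  assumes k: "reached k" "\<not> stops p (t k)"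
  shows "\<tau> * min 1 (r * \<nu> / \<gamma>D) \<le> trial k 0" "trial k 0 \<le> 1"
proof -
  let ?d = "direction f l u p (x k) (s k) (t k)" and ?a = "min 1 (r * \<nu> / \<gamma>D)"
  have "norm ?d \<le> \<gamma>D * norm (dbar k)"
    unfolding direction_def
    by (rule order_trans[OF norm_matrix_vector_mult_le])
       (use reached_iterate(2)[OF k(1)] in \<open>intro mult_right_mono, auto\<close>)
  also have "\<dots> \<le> \<gamma>D * (1 / \<nu>)" using norm_d_bar_bounds(2)[OF k] params by (intro mult_left_mono) auto
  finally have "?a * norm ?d \<le> (r * \<nu> / \<gamma>D) * (\<gamma>D * (1 / \<nu>))"
    using params r by (intro mult_mono) auto
  then have "?a * norm ?d \<le> r" using params by simp
  from real_min_alpha_max[OF reached_iterate(1)[OF k(1)] this]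
  have "?a \<le> real_of_ereal (min 1 (alpha_max l u (x k) ?d))"
    "real_of_ereal (min 1 (alpha_max l u (x k) ?d)) \<le> 1"
    using params r by auto
  moreover have "trial k 0 = \<tau> * real_of_ereal (min 1 (alpha_max l u (x k) ?d))"
    by (simp add: alpha_trial_def p)
  moreover have "0 < ?a" using params r by simp
  ultimately show "\<tau> * ?a \<le> trial k 0" "trial k 0 \<le> 1"
    using params by (auto intro!: mult_left_mono mult_le_one elim: order_trans[OF less_imp_le])
qed

lemma trial_0_pos:
  assumes "reached k" "\<not> stops p (t k)"
  shows "0 < trial k 0"
proof -
  have "0 < \<tau> * min 1 (r * \<nu> / \<gamma>D)" using params r by simp
  with trial_0_bounds(1)[OF assms] show ?thesis by linarith
qed

lemma trial_bounds:
  assumes "reached k" "\<not> stops p (t k)"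
  shows "0 < trial k j" "trial k j \<le> \<beta> ^ j" "trial k j \<le> 1"
proof -
  show "0 < trial k j" unfolding trial_eq[of k j] using trial_0_pos[OF assms] params by simp
  have "\<beta> ^ j * trial k 0 \<le> \<beta> ^ j * 1"
    using trial_0_bounds(2)[OF assms] params by (intro mult_left_mono) auto
  then show *: "trial k j \<le> \<beta> ^ j" by (simp only: trial_eq[of k j] mult_1_right)
  have "\<beta> ^ j \<le> 1" using params by (simp add: power_le_one)
  with * show "trial k j \<le> 1" by linarith
qed

section \<open>The line search\<close>

lemma acceptedI:
  assumes k: "reached k" "\<not> stops p (t k)" and step: "trial k j * norm (dbar k) \<le> 3 * sqrt \<epsilon> / P"
  shows "accepted k j"
proof -
  obtain \<theta> where opt: "\<theta> \<ge> sqrt \<epsilon>" "s k \<bullet> s k + (t k)\<^sup>2 = 1"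
    "B_bar f l u (x k) *v s k + t k *\<^sub>R g_bar f l u (x k) = - \<theta> *\<^sub>R s k"
    "g_bar f l u (x k) \<bullet> s k = (sqrt \<epsilon> - \<theta>) * t k" using optimality[OF k(1)] by blast
  have "f (x k + trial k j *\<^sub>R direction f l u p (x k) (s k) (t k)) - f (x k)
      \<le> - (\<gamma> / 6) * trial k j ^ 3 * norm (dbar k) ^ 3"
    using step small(1) params
    by (intro sufficient_decrease[OF reached_iterate(1)[OF k(1)] opt trial_bounds(1,3)[OF k] k(2)
          _ _ _ reached_iterate(2)[OF k(1)]])
       (auto simp: p)
  then show ?thesis by (simp add: accepts_def Let_def p)
qed

text \<open>The trial step is at most \<beta>^j, and the \<nu> inside the logarithm compensates the
  bound 1 / \<nu> on the direction. As \<beta> < 1, powers of \<beta> decrease in the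
  exponent.\<close>

lemma accepted_eventually:
  assumes k: "reached k" "\<not> stops p (t k)" and j: "log \<beta> (3 * sqrt \<epsilon> * \<nu> / P) \<le> real j"
  shows "accepted k j"
proof (rule acceptedI[OF k])
  have pos: "3 * sqrt \<epsilon> * \<nu> / P > 0" using params P_pos by simp
  have "\<beta> ^ j = \<beta> powr real j" using params by (simp add: powr_realpow)
  also have "\<dots> \<le> \<beta> powr log \<beta> (3 * sqrt \<epsilon> * \<nu> / P)"
    using j params by (intro powr_mono') auto
  also have "\<dots> = 3 * sqrt \<epsilon> * \<nu> / P" using params pos by (intro powr_log_cancel) auto
  finally have "trial k j \<le> 3 * sqrt \<epsilon> * \<nu> / P" using trial_bounds(2)[OF k, of j] by linarith
  then have "trial k j * norm (dbar k) \<le> 3 * sqrt \<epsilon> * \<nu> / P * (1 / \<nu>)"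
    using trial_bounds(1)[OF k, of j] norm_d_bar_bounds(2)[OF k] pos by (intro mult_mono) auto
  then show "trial k j * norm (dbar k) \<le> 3 * sqrt \<epsilon> / P" using params by simp
qed

lemma accepted_exists:
  assumes "reached k" "\<not> stops p (t k)"
  shows "\<exists>j. accepted k j"
  using accepted_eventually[OF assms] real_nat_ceiling_ge by blast

text \<open>A negative logarithm means that the very first trial is accepted, in agreement with
  \<open>nat\<close> truncating to 0.\<close>

lemma index_le:
  assumes "reached k" "\<not> stops p (t k)"
  shows "index k \<le> nat \<lceil>log \<beta> (3 * sqrt \<epsilon> * \<nu> / P)\<rceil>"
  unfolding search_index_def
  by (rule Least_le) (rule accepted_eventually[OF assms real_nat_ceiling_ge])

lemma reached_Suc: "reached k \<Longrightarrow> \<not> stops p (t k) \<Longrightarrow> reached (Suc k)"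
  using accepted_exists[of k] by (auto simp: reaches_def less_Suc_eq)

lemma iterate_Suc:
  assumes "reached k" "\<not> stops p (t k)"
  shows "x (Suc k) = x k + trial k (index k) *\<^sub>R direction f l u p (x k) (s k) (t k)"
  using run assms accepted_exists[OF assms] by (simp add: sobasip_run_def)

text \<open>The two arguments of \<open>min\<close> are the two ways a search can end. If the first
  trial is accepted, step and direction have their own lower bounds \<alpha> and \<Delta>. Otherwise
  the preceding trial was rejected, so by \<open>acceptedI\<close> it exceeded the threshold, and
  the accepted one is \<beta> times as long.\<close>

lemma function_decrease:
  assumes k: "reached k" "\<not> stops p (t k)" and \<alpha>: "0 < \<alpha>" "\<alpha> \<le> trial k 0"
  shows "f (x (Suc k)) \<le> f (x k) - \<gamma> / 6 * min (2 * sqrt \<epsilon> * \<alpha> / L) (3 * \<beta> * sqrt \<epsilon> / P) ^ 3"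
proof -
  have "accepted k (index k)"
    unfolding search_index_def using accepted_exists[OF k] by (rule LeastI_ex)
  then have dec: "f (x (Suc k)) - f (x k) \<le> - (\<gamma> / 6) * trial k (index k) ^ 3 * norm (dbar k) ^ 3"
    by (simp add: accepts_def Let_def iterate_Suc[OF k] p)
  have "min (2 * sqrt \<epsilon> * \<alpha> / L) (3 * \<beta> * sqrt \<epsilon> / P) \<le> trial k (index k) * norm (dbar k)"
  proof (cases "index k")
    case 0
    have "\<alpha> * (2 * sqrt \<epsilon> / L) \<le> trial k 0 * norm (dbar k)"
      using \<alpha> norm_d_bar_bounds(1)[OF k] params by (intro mult_mono) auto
    then show ?thesis by (simp add: 0 mult_ac)
  next
    case (Suc j)
    have "\<not> accepted k j"
      using not_less_Least[of j "\<lambda>j. accepted k j"] Suc by (simp add: search_index_def)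
    then have "3 * sqrt \<epsilon> / P \<le> trial k j * norm (dbar k)" using acceptedI[OF k, of j] by linarith
    then have "\<beta> * (3 * sqrt \<epsilon> / P) \<le> \<beta> * (trial k j * norm (dbar k))"
      using params by (intro mult_left_mono) auto
    moreover have "trial k (Suc j) = \<beta> * trial k j"
      by (simp add: trial_eq[of k "Suc j"] trial_eq[of k j])
    ultimately show ?thesis by (simp add: Suc mult_ac)
  qed
  then have "min (2 * sqrt \<epsilon> * \<alpha> / L) (3 * \<beta> * sqrt \<epsilon> / P) ^ 3 \<le> (trial k (index k) * norm (dbar k)) ^ 3"
    using \<alpha> params P_pos by (intro power_mono) auto
  then have "\<gamma> / 6 * min (2 * sqrt \<epsilon> * \<alpha> / L) (3 * \<beta> * sqrt \<epsilon> / P) ^ 3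
      \<le> \<gamma> / 6 * (trial k (index k) * norm (dbar k)) ^ 3"
    using params by (intro mult_left_mono) auto
  with dec show ?thesis by (simp add: power_mult_distrib)
qed

section \<open>Counting iterations and steps\<close>

text \<open>Reaching iteration K + 1 means that iterations 1 to K all took a line search step, so
  their decreases telescope. The last iterate is feasible, which brings in the infimum.\<close>

lemma total_decrease:
  assumes \<alpha>: "0 < \<alpha>" "\<And>k. reached k \<Longrightarrow> \<not> stops p (t k) \<Longrightarrow> \<alpha> \<le> trial k 0"
    and K: "reached (Suc K)"
  shows "real K * (\<gamma> / 6 * min (2 * sqrt \<epsilon> * \<alpha> / L) (3 * \<beta> * sqrt \<epsilon> / P) ^ 3)
           \<le> f (x 1) - Inf (f ` feasible l u)"
proof -
  define \<eta> where "\<eta> = \<gamma> / 6 * min (2 * sqrt \<epsilon> * \<alpha> / L) (3 * \<beta> * sqrt \<epsilon> / P) ^ 3"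
  have "f (x (Suc K)) \<le> f (x 1) - real K * \<eta>"
    using K
  proof (induction K)
    case (Suc K)
    have k: "reached (Suc K)" "\<not> stops p (t (Suc K))"
      using Suc.prems by (auto simp: reaches_def)
    have "f (x (Suc (Suc K))) \<le> f (x (Suc K)) - \<eta>"
      using function_decrease[OF k \<alpha>(1) \<alpha>(2)[OF k]] by (simp add: \<eta>_def)
    with Suc.IH[OF k(1)] show ?case by (simp add: algebra_simps)
  qed simp
  moreover have "x (Suc K) \<in> strictly_feasible l u"
    using cball_feasible[OF reached_iterate(1)[OF K]] r by auto
  then have "x (Suc K) \<in> feasible l u" by (auto simp: strictly_feasible_def feasible_def less_imp_le)
  then have "Inf (f ` feasible l u) \<le> f (x (Suc K))" using bdd_below by (intro cINF_lower)
  ultimately show ?thesis by (simp add: \<eta>_def)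
qed

text \<open>An endless run would decrease f infinitely often by the fixed positive amount \<eta>,
  against boundedness below. The lower bound on the initial steps from \<open>trial_0_bounds\<close>
  is what makes \<eta> fixed.\<close>

lemma terminates: "\<exists>K. terminates_at f l u p x s t K"
proof (rule ccontr)
  assume "\<not> ?thesis"
  then have no_stop: "reached k \<Longrightarrow> \<not> stops p (t k)" for k by (auto simp: terminates_at_def)
  have all: "reached (Suc k)" for k
  proof (induction k)
    case 0
    show ?case by (simp add: reaches_def)
  next
    case (Suc k)
    then show ?case using reached_Suc no_stop by blast
  qed
  define \<alpha> where "\<alpha> = \<tau> * min 1 (r * \<nu> / \<gamma>D)"
  have \<alpha>: "0 < \<alpha>" using params r by (simp add: \<alpha>_def)
  define \<eta> where "\<eta> = \<gamma> / 6 * min (2 * sqrt \<epsilon> * \<alpha> / L) (3 * \<beta> * sqrt \<epsilon> / P) ^ 3"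
  have "\<eta> > 0" using \<alpha> params P_pos by (simp add: \<eta>_def)
  then obtain K where "f (x 1) - Inf (f ` feasible l u) < real K * \<eta>"
    using ex_less_of_nat_mult by blast
  moreover have "real K * \<eta> \<le> f (x 1) - Inf (f ` feasible l u)"
    unfolding \<eta>_def using \<alpha> trial_0_bounds(1) all by (intro total_decrease) (auto simp: \<alpha>_def)
  ultimately show False by simp
qed

text \<open>The stopping iteration counts 1 and has no search. Each earlier one counts 1 for itself
  and one more than its search index, since indices start at 0.\<close>

lemma num_steps_le:
  assumes "terminates_at f l u p x s t K"
  shows "real (num_steps f l u p x s t K)
    \<le> 1 + real (K - 1) * (2 + real (nat \<lceil>log \<beta> (3 * sqrt \<epsilon> * \<nu> / P)\<rceil>))"
proof -
  let ?J = "nat \<lceil>log \<beta> (3 * sqrt \<epsilon> * \<nu> / P)\<rceil>"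
  have K: "reached K" using assms by (simp add: terminates_at_def)
  then have K1: "1 \<le> K" by (simp add: reaches_def)
  have "Suc (index k) \<le> Suc ?J" if "k \<in> {1..<K}" for k
  proof -
    have "reached k" "\<not> stops p (t k)" using K that by (auto simp: reaches_def)
    then show ?thesis using index_le by simp
  qed
  then have "(\<Sum>k\<in>{1..<K}. Suc (index k)) \<le> of_nat (card {1..<K}) * Suc ?J"
    by (rule sum_bounded_above)
  then have "num_steps f l u p x s t K \<le> K + (K - 1) * Suc ?J"
    by (simp add: num_steps_def)
  then have "real (num_steps f l u p x s t K) \<le> real (K + (K - 1) * Suc ?J)"
    by (rule of_nat_mono)
  also have "\<dots> = 1 + real (K - 1) * (2 + real ?J)"
    using K1 by (cases K) (simp_all add: algebra_simps)
  finally show ?thesis .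
qed

text \<open>Passes from P, which contains M, to Q, which contains L: the decrease per iteration
  costs \<kappa>^3, and doubling the logarithm pays for its shift and for all additive constants. A
  stop in the first iteration is covered by the 1 in \<open>max\<close>.\<close>

lemma num_steps_bound:
  fixes \<kappa> \<alpha> :: real and K :: nat
  defines "Q \<equiv> L * \<gamma>D ^ 3 + \<gamma>"
  assumes \<kappa>: "\<kappa> \<ge> 1" "P \<le> \<kappa> * Q"
    and \<Lambda>: "log \<beta> (1 / \<kappa>) + 4 \<le> log \<beta> (3 * sqrt \<epsilon> * \<nu> / Q)"
    and K: "terminates_at f l u p x s t K"
    and \<alpha>: "0 < \<alpha>" "\<And>k. reached k \<Longrightarrow> \<not> stops p (t k) \<Longrightarrow> \<alpha> \<le> trial k 0"
  shows "real (num_steps f l u p x s t K) \<le> max 1 (2 * \<kappa> ^ 3 *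
    (max (3 * L ^ 3 / (4 * \<gamma> * \<alpha> ^ 3)) (2 * Q ^ 3 / (9 * \<gamma> * \<beta> ^ 3))
      * \<lceil>log \<beta> (3 * sqrt \<epsilon> * \<nu> / Q)\<rceil> * (f (x 1) - Inf (f ` feasible l u)) * \<epsilon> powr (- 3/2)))"
proof (cases "K = 1")
  case True
  then have "num_steps f l u p x s t K = 1" by (simp add: num_steps_def)
  then show ?thesis by simp
next
  case False
  define \<Lambda>Q where "\<Lambda>Q = log \<beta> (3 * sqrt \<epsilon> * \<nu> / Q)"
  define \<Lambda>P where "\<Lambda>P = log \<beta> (3 * sqrt \<epsilon> * \<nu> / P)"
  define \<Phi> where "\<Phi> = f (x 1) - Inf (f ` feasible l u)"
  define \<eta> where "\<eta> = \<gamma> / 6 * min (2 * sqrt \<epsilon> * \<alpha> / L) (3 * \<beta> * sqrt \<epsilon> / P) ^ 3"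
  define W where "W = max (3 * L ^ 3 / (4 * \<gamma> * \<alpha> ^ 3)) (2 * Q ^ 3 / (9 * \<gamma> * \<beta> ^ 3))"
  have Q: "Q > 0" using params by (simp add: Q_def add_pos_pos)
  have reached: "reached K" using K by (simp add: terminates_at_def)
  then have K2: "K \<ge> 2" using False by (simp add: reaches_def)
  then obtain N where N: "K = Suc N" "N \<ge> 1" by (metis Suc_le_D Suc_1 Suc_le_mono One_nat_def)
  have e: "sqrt \<epsilon> ^ 3 = \<epsilon> powr (3/2)" using params by (simp add: powr_half_sqrt[symmetric] powr_power)
  have W: "W \<ge> 0" using params \<alpha> by (simp add: W_def le_max_iff_disj)
  have "real N * \<eta> \<le> \<Phi>"
    unfolding \<eta>_def \<Phi>_def using \<alpha> reached N by (intro total_decrease) auto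
  moreover have "\<epsilon> powr (3/2) \<le> \<kappa> ^ 3 * W * \<eta>"
  proof -
    define m where "m = min (2 * \<alpha> / L) (3 * \<beta> / P)"
    have "min (2 * sqrt \<epsilon> * \<alpha> / L) (3 * \<beta> * sqrt \<epsilon> / P) = sqrt \<epsilon> * m"
      using params by (simp add: m_def min_mult_distrib_left mult_ac)
    then have \<eta>m: "\<eta> = \<gamma> / 6 * m ^ 3 * \<epsilon> powr (3/2)"
      by (simp add: \<eta>_def power_mult_distrib e)
    have "1 \<le> \<kappa> ^ 3 * W * (\<gamma> / 6 * m ^ 3)"
    proof (cases "2 * \<alpha> / L \<le> 3 * \<beta> / P")
      case True
      then have m: "m = 2 * \<alpha> / L" by (simp add: m_def)
      \<comment> \<open>The two entries of W are the reciprocals of \<gamma>/6 times the cubes of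
        2\<alpha>/L and 3\<beta>/Q, the two possible step lengths divided by sqrt \<epsilon>, the
        second with Q in place of P.\<close>
      have "1 = (3 * L ^ 3 / (4 * \<gamma> * \<alpha> ^ 3)) * (\<gamma> / 6 * m ^ 3)"
        using params \<alpha> by (simp add: m power_divide field_simps power_mult_distrib)
      also have "\<dots> \<le> W * (\<gamma> / 6 * m ^ 3)"
        using params \<alpha> by (intro mult_right_mono) (auto simp: W_def m)
      also have "\<dots> \<le> \<kappa> ^ 3 * (W * (\<gamma> / 6 * m ^ 3))"
      proof -
        have "1 * (W * (\<gamma> / 6 * m ^ 3)) \<le> \<kappa> ^ 3 * (W * (\<gamma> / 6 * m ^ 3))"
          using params \<alpha> \<kappa> W by (intro mult_right_mono mult_nonneg_nonneg) (auto simp: m one_le_power)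
        then show ?thesis by simp
      qed
      finally show ?thesis by (simp add: mult_ac)
    next
      case False
      then have m: "m = 3 * \<beta> / P" by (simp add: m_def)
      have "3 * \<beta> / (\<kappa> * Q) \<le> m" unfolding m using \<kappa> P_pos params by (intro divide_left_mono) (auto intro!: mult_pos_pos Q)
      then have m3: "(3 * \<beta> / (\<kappa> * Q)) ^ 3 \<le> m ^ 3" using params \<kappa> Q by (intro power_mono) auto
      have "1 = \<kappa> ^ 3 * (2 * Q ^ 3 / (9 * \<gamma> * \<beta> ^ 3)) * (\<gamma> / 6 * (3 * \<beta> / (\<kappa> * Q)) ^ 3)"
        using params \<kappa> Q by (simp add: power_divide field_simps power_mult_distrib)
      also have "\<dots> \<le> \<kappa> ^ 3 * W * (\<gamma> / 6 * m ^ 3)"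
        using params \<kappa> Q W m3 by (intro mult_mono mult_nonneg_nonneg) (auto simp: W_def)
      finally show ?thesis .
    qed
    then have "1 * \<epsilon> powr (3/2) \<le> \<kappa> ^ 3 * W * (\<gamma> / 6 * m ^ 3) * \<epsilon> powr (3/2)"
      by (intro mult_right_mono) auto
    then show ?thesis by (simp add: \<eta>m mult_ac)
  qed
  ultimately have NK: "real N \<le> \<kappa> ^ 3 * W * \<Phi> * \<epsilon> powr (- 3/2)"
  proof -
    have "real N * \<epsilon> powr (3/2) \<le> real N * (\<kappa> ^ 3 * W * \<eta>)"
      using \<open>\<epsilon> powr (3/2) \<le> \<kappa> ^ 3 * W * \<eta>\<close> by (intro mult_left_mono) auto
    also have "\<dots> = \<kappa> ^ 3 * W * (real N * \<eta>)" by simp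
    also have "\<dots> \<le> \<kappa> ^ 3 * W * \<Phi>"
      using \<open>real N * \<eta> \<le> \<Phi>\<close> W \<kappa> by (intro mult_left_mono mult_nonneg_nonneg) auto
    finally have "real N * \<epsilon> powr (3/2) * \<epsilon> powr (- 3/2) \<le> \<kappa> ^ 3 * W * \<Phi> * \<epsilon> powr (- 3/2)"
      by (intro mult_right_mono) auto
    then show ?thesis using params by (simp add: mult.assoc flip: powr_add)
  qed
  have "\<Lambda>P \<le> log \<beta> (3 * sqrt \<epsilon> * \<nu> / Q * (1 / \<kappa>))"
  proof -
    have "3 * sqrt \<epsilon> * \<nu> / (\<kappa> * Q) \<le> 3 * sqrt \<epsilon> * \<nu> / P"
      using \<kappa> P_pos params Q by (intro divide_left_mono) auto
    then have "ln (3 * sqrt \<epsilon> * \<nu> / (\<kappa> * Q)) \<le> ln (3 * sqrt \<epsilon> * \<nu> / P)"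
      using \<kappa> P_pos params Q by (intro ln_mono) auto
    then show ?thesis
      unfolding \<Lambda>P_def log_def using params by (simp add: divide_right_mono_neg mult_ac)
  qed
  also have "\<dots> = \<Lambda>Q + log \<beta> (1 / \<kappa>)"
    unfolding \<Lambda>Q_def using params \<kappa> Q by (intro log_mult_pos) auto
  finally have \<Lambda>PQ: "\<Lambda>P + 4 \<le> 2 * \<Lambda>Q" using \<Lambda> by (simp add: \<Lambda>Q_def)
  have "log \<beta> (1 / \<kappa>) \<ge> 0"
    unfolding log_def using params \<kappa> by (intro divide_nonpos_neg) (auto simp: ln_div)
  then have "\<Lambda>Q \<ge> 4" using \<Lambda> by (simp add: \<Lambda>Q_def)
  \<comment> \<open>The 4 in the hypothesis on the logarithm is this 3 plus 1 for rounding up. If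
    the ceiling is truncated to 0, the bound \<Lambda>Q \<ge> 4 is enough.\<close>
  have J: "3 + real (nat \<lceil>\<Lambda>P\<rceil>) \<le> 2 * real_of_int \<lceil>\<Lambda>Q\<rceil>"
  proof -
    have "real (nat \<lceil>\<Lambda>P\<rceil>) \<le> max 0 (\<Lambda>P + 1)" 
      using of_int_ceiling_le_add_one[of \<Lambda>P] by (cases "\<lceil>\<Lambda>P\<rceil> \<ge> 0") auto
    moreover have "\<Lambda>Q \<le> real_of_int \<lceil>\<Lambda>Q\<rceil>" by simp
    ultimately show ?thesis using \<Lambda>PQ \<open>\<Lambda>Q \<ge> 4\<close> by linarith
  qed
  have "real (num_steps f l u p x s t K) \<le> 1 + real N * (2 + real (nat \<lceil>\<Lambda>P\<rceil>))"
    using num_steps_le[OF K] by (simp add: N \<Lambda>P_def)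
  \<comment> \<open>As N \<ge> 1, the single step of the stopping iteration is charged to the
    others.\<close>
  also have "\<dots> \<le> real N * (3 + real (nat \<lceil>\<Lambda>P\<rceil>))" using N(2) by (simp add: algebra_simps)
  also have "\<dots> \<le> \<kappa> ^ 3 * W * \<Phi> * \<epsilon> powr (- 3/2) * (2 * real_of_int \<lceil>\<Lambda>Q\<rceil>)"
    using NK J by (intro mult_mono) auto
  finally have "real (num_steps f l u p x s t K)
    \<le> 2 * \<kappa> ^ 3 * (W * real_of_int \<lceil>\<Lambda>Q\<rceil> * \<Phi> * \<epsilon> powr (- 3/2))" by (simp add: mult_ac)
  then show ?thesis unfolding W_def \<Lambda>Q_def \<Phi>_def by (rule max.coboundedI2)
qed

end

section \<open>The returned point\<close>

context interior_region
begin

text \<open>Every vector is a scaled one, so a lower bound on the form of \<open>B_bar\<close> can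
  be transferred to the Hessian in all directions.\<close>

lemma D_inv_surj:
  assumes "x \<in> X"
  obtains z where "D_inv f l u x *v z = y"
proof -
  have "\<bar>scaling_v f l u x $ i\<bar> > 0" for i using scaling_v_ge[OF assms, of i] r by linarith
  then have "D_inv f l u x *v (\<chi> i. y $ i / sqrt \<bar>scaling_v f l u x $ i\<bar>) = y"
    by (simp add: vec_eq_iff D_inv_def diag_mult_vec_component)
  then show thesis by (rule that)
qed

text \<open>The scaling may jump between the last two points because it depends on the signs of the
  gradient. Since it is bounded below on \<open>X\<close>, the estimates pass through the unscaled gradient and
  Hessian; in particular the gradient at \<open>x\<close> is \<open>O(e)\<close>, so \<open>C_bar\<close> is negligible.\<close>

lemma returned_point_stationary:
  assumes bounds: "0 < \<gamma>D" "0 < \<gamma>B" "0 < L" "0 \<le> G"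
    and lipschitz: "\<And>x y. x \<in> X \<Longrightarrow> y \<in> X \<Longrightarrow> opnorm (hess f x - hess f y) \<le> L * norm (x - y)"
    and grad_le: "\<And>x. x \<in> X \<Longrightarrow> norm (grad f x) \<le> G"
  shows "\<exists>C>0. \<forall>e x d \<theta>. 0 < e \<and> e \<le> 1 \<and> \<gamma>D * (2 * e / L) \<le> r \<and>
      x \<in> X \<and> x + D_inv f l u x *v d \<in> X \<and> opnorm (D_inv f l u x) \<le> \<gamma>D \<and>
      opnorm (D_inv f l u (x + D_inv f l u x *v d)) \<le> \<gamma>D \<and> opnorm (B_bar f l u x) \<le> \<gamma>B \<and>
      0 \<le> \<theta> \<and> norm d \<le> 2 * e / L \<and>
      B_bar f l u x *v d + g_bar f l u x = - \<theta> *\<^sub>R d \<and> g_bar f l u x \<bullet> d = e - \<theta> \<and>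
      (\<forall>z. z \<bullet> (B_bar f l u x *v z) \<ge> - \<theta> * (z \<bullet> z)) \<longrightarrow>
    norm (g_bar f l u (x + D_inv f l u x *v d)) \<le> C * e\<^sup>2 \<and>
    lambda_min (B_bar f l u (x + D_inv f l u x *v d)) \<ge> - C * e"
proof -
  \<comment> \<open>These are the constants in \<theta> \<le> c\<theta> * e, in norm (grad f x)
    \<le> cg * e, and in the gradient and eigenvalue estimates at the new point.\<close>
  define c\<theta> where "c\<theta> = 1 + \<gamma>D * G * (2 / L)"
  define cg where "cg = (\<gamma>B + c\<theta>) * (2 / L) / sqrt r"
  define c1 where "c1 = \<gamma>D * ((\<gamma>D * (CARD('n) * (M / 2 * (\<gamma>D * (2 / L))\<^sup>2)) + (c\<theta> + cg) * (2 / L)) / sqrt r)"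
  define c2 where "c2 = ((c\<theta> + cg) / r + 2 * \<gamma>D) * \<gamma>D\<^sup>2"
  have sr: "sqrt r > 0" using r by simp
  have c\<theta>: "c\<theta> \<ge> 0" using bounds by (simp add: c\<theta>_def)
  have cg: "cg \<ge> 0" using bounds c\<theta> r by (simp add: cg_def)
  have c1: "c1 \<ge> 0" using bounds c\<theta> cg r M_nonneg by (simp add: c1_def)
  have c2: "c2 \<ge> 0" using bounds c\<theta> cg r by (simp add: c2_def)
  show ?thesis
  proof (intro exI[of _ "c1 + c2 + 1"] conjI allI impI; (elim conjE)?)
    show "0 < c1 + c2 + 1" using c1 c2 by simp
  next
    fix e x d \<theta>
    define h where "h = D_inv f l u x *v d"
    assume e: "0 < e" "e \<le> 1" and r_small: "\<gamma>D * (2 * e / L) \<le> r"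
      and X: "x \<in> X" "x + D_inv f l u x *v d \<in> X" and D: "opnorm (D_inv f l u x) \<le> \<gamma>D"
      "opnorm (D_inv f l u (x + D_inv f l u x *v d)) \<le> \<gamma>D" and B: "opnorm (B_bar f l u x) \<le> \<gamma>B"
      and \<theta>: "0 \<le> \<theta>" and d: "norm d \<le> 2 * e / L"
      and kkt: "B_bar f l u x *v d + g_bar f l u x = - \<theta> *\<^sub>R d" "g_bar f l u x \<bullet> d = e - \<theta>"
      and psd: "\<forall>z. z \<bullet> (B_bar f l u x *v z) \<ge> - \<theta> * (z \<bullet> z)"
    have d': "norm d \<le> 2 / L * e" using d by simp
    have D_le: "norm (D_inv f l u x *v y) \<le> \<gamma>D * norm y" for y
      by (rule order_trans[OF norm_matrix_vector_mult_le]) (use D in \<open>intro mult_right_mono, auto\<close>)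
    have D'_le: "norm (D_inv f l u (x + h) *v y) \<le> \<gamma>D * norm y" for y
      by (rule order_trans[OF norm_matrix_vector_mult_le])
         (use D in \<open>intro mult_right_mono, auto simp: h_def\<close>)
    have h: "norm h \<le> \<gamma>D * (2 / L) * e"
    proof -
      have "norm h \<le> \<gamma>D * norm d" unfolding h_def by (rule D_le)
      also have "\<dots> \<le> \<gamma>D * (2 / L * e)" using d' bounds by (intro mult_left_mono) auto
      finally show ?thesis by (simp add: mult_ac)
    qed
    \<comment> \<open>The second row of the eigenvector equation gives \<theta> = e minus an inner
      product that is O(norm d), so \<theta> itself is of order e.\<close>
    have \<theta>_le: "\<theta> \<le> c\<theta> * e"
    proof -
      have "\<theta> = e - g_bar f l u x \<bullet> d" using kkt(2) by simp
      also have "\<dots> \<le> e + norm (g_bar f l u x) * norm d"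
        using Cauchy_Schwarz_ineq2[of "g_bar f l u x" d] by linarith
      also have "norm (g_bar f l u x) * norm d \<le> (\<gamma>D * G) * (2 / L * e)"
      proof (rule mult_mono[OF _ d'])
        have "norm (g_bar f l u x) \<le> \<gamma>D * norm (grad f x)" unfolding g_bar_def by (rule D_le)
        also have "\<dots> \<le> \<gamma>D * G" using grad_le[OF X(1)] bounds by (intro mult_left_mono) auto
        finally show "norm (g_bar f l u x) \<le> \<gamma>D * G" .
      qed (use bounds in auto)
      finally show ?thesis by (simp add: c\<theta>_def algebra_simps)
    qed
    have \<theta>1: "\<theta> \<le> c\<theta>" using \<theta>_le mult_left_mono[OF e(2) c\<theta>] by simp
    have g_le: "norm (grad f x) \<le> cg * e"
    proof -
      have "sqrt r * norm (grad f x) \<le> norm (g_bar f l u x)"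
        unfolding g_bar_def by (rule norm_D_inv_mult_ge[OF X(1)])
      also have "g_bar f l u x = - (\<theta> *\<^sub>R d) - B_bar f l u x *v d" using kkt(1) by (simp add: algebra_simps eq_neg_iff_add_eq_0)
      also have "norm \<dots> \<le> norm (\<theta> *\<^sub>R d) + norm (B_bar f l u x *v d)"
        by (rule order_trans[OF norm_triangle_ineq4]) simp
      also have "\<dots> \<le> c\<theta> * norm d + \<gamma>B * norm d"
      proof (rule add_mono)
        show "norm (\<theta> *\<^sub>R d) \<le> c\<theta> * norm d" using \<theta> \<theta>1 by (simp add: mult_right_mono)
        show "norm (B_bar f l u x *v d) \<le> \<gamma>B * norm d"
          by (rule order_trans[OF norm_matrix_vector_mult_le]) (use B in \<open>intro mult_right_mono, auto\<close>)
      qed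
      also have "\<dots> = (\<gamma>B + c\<theta>) * norm d" by (simp add: algebra_simps)
      also have "\<dots> \<le> (\<gamma>B + c\<theta>) * (2 / L * e)" using d' bounds c\<theta> by (intro mult_left_mono) auto
      finally have "norm (grad f x) \<le> (\<gamma>B + c\<theta>) * (2 / L * e) / sqrt r"
        unfolding pos_le_divide_eq[OF sr] mult.commute[of _ "sqrt r"] .
      then show ?thesis by (simp add: cg_def mult_ac)
    qed
    have "norm (g_bar f l u (x + h)) \<le> c1 * e\<^sup>2"
    proof -
      define \<rho> where "\<rho> = grad f (x + h) - grad f x - hess f x *v h"
      have "norm h \<le> r" using h r_small by (simp add: mult_ac)
      then have "norm \<rho> \<le> CARD('n) * (M / 2 * (norm h)\<^sup>2)"
        unfolding \<rho>_def
        by (intro grad_taylor_bound[OF C3 cball_S[OF X(1)] _ third_deriv_le[OF X(1)]])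
      also have "\<dots> \<le> CARD('n) * (M / 2 * (\<gamma>D * (2 / L) * e)\<^sup>2)"
        using h M_nonneg by (intro mult_left_mono power_mono) auto
      finally have \<rho>: "norm \<rho> \<le> CARD('n) * (M / 2 * (\<gamma>D * (2 / L))\<^sup>2) * e\<^sup>2"
        by (simp only: power_mult_distrib mult_ac)
      \<comment> \<open>The Newton effect: the linearised gradient at the new point, scaled at the
        old one, is only -\<theta> d - C d. Since \<theta>, the gradient inside C, and d are all of
        order e, this is of order e^2.\<close>
      have "D_inv f l u x *v (grad f x + hess f x *v h)
          = g_bar f l u x + (B_bar f l u x *v d - C_bar f l u x *v d)"
        by (simp add: B_bar_mult_vec g_bar_def h_def matrix_vector_right_distrib)
      also have "\<dots> = - (\<theta> *\<^sub>R d) - C_bar f l u x *v d"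
        using kkt(1) by (simp add: algebra_simps eq_neg_iff_add_eq_0)
      finally have "D_inv f l u x *v grad f (x + h) = D_inv f l u x *v \<rho> + (- (\<theta> *\<^sub>R d) - C_bar f l u x *v d)"
        by (simp add: \<rho>_def matrix_vector_right_distrib matrix_vector_mult_diff_distrib algebra_simps)
      then have "sqrt r * norm (grad f (x + h)) \<le> norm (D_inv f l u x *v \<rho> + (- (\<theta> *\<^sub>R d) - C_bar f l u x *v d))"
        using norm_D_inv_mult_ge[OF X(1), of "grad f (x + h)"] by simp
      also have "\<dots> \<le> norm (D_inv f l u x *v \<rho>) + (norm (\<theta> *\<^sub>R d) + norm (C_bar f l u x *v d))"
        by (intro order_trans[OF norm_triangle_ineq] add_mono order_refl order_trans[OF norm_triangle_ineq4]) simp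
      also have "\<dots> \<le> \<gamma>D * (CARD('n) * (M / 2 * (\<gamma>D * (2 / L))\<^sup>2) * e\<^sup>2)
          + (c\<theta> * e * (2 / L * e) + cg * e * (2 / L * e))"
      proof (intro add_mono)
        show "norm (D_inv f l u x *v \<rho>) \<le> \<gamma>D * (CARD('n) * (M / 2 * (\<gamma>D * (2 / L))\<^sup>2) * e\<^sup>2)"
          by (rule order_trans[OF D_le]) (use \<rho> bounds in \<open>intro mult_left_mono, auto\<close>)
        have "\<theta> * norm d \<le> c\<theta> * e * (2 / L * e)"
          using \<theta>_le d' \<theta> c\<theta> e by (intro mult_mono) auto
        then show "norm (\<theta> *\<^sub>R d) \<le> c\<theta> * e * (2 / L * e)" using \<theta> by simp
        have "norm (grad f x) * norm d \<le> cg * e * (2 / L * e)"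
          using g_le d' cg e by (intro mult_mono) auto
        then show "norm (C_bar f l u x *v d) \<le> cg * e * (2 / L * e)"
          by (rule order_trans[OF norm_C_bar_mult_le])
      qed
      also have "\<dots> = (\<gamma>D * (CARD('n) * (M / 2 * (\<gamma>D * (2 / L))\<^sup>2)) + (c\<theta> + cg) * (2 / L)) * e\<^sup>2"
        by (simp only: power2_eq_square distrib_left distrib_right mult_ac)
      finally have g': "norm (grad f (x + h))
          \<le> (\<gamma>D * (CARD('n) * (M / 2 * (\<gamma>D * (2 / L))\<^sup>2)) + (c\<theta> + cg) * (2 / L)) * e\<^sup>2 / sqrt r"
        unfolding pos_le_divide_eq[OF sr] mult.commute[of _ "sqrt r"] .
      have "norm (g_bar f l u (x + h)) \<le> \<gamma>D * norm (grad f (x + h))"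
        unfolding g_bar_def by (rule D'_le)
      also have "\<dots> \<le> \<gamma>D * ((\<gamma>D * (CARD('n) * (M / 2 * (\<gamma>D * (2 / L))\<^sup>2)) + (c\<theta> + cg) * (2 / L)) * e\<^sup>2 / sqrt r)"
        using g' bounds by (intro mult_left_mono) auto
      also have "\<dots> = c1 * e\<^sup>2" by (simp add: c1_def)
      finally show ?thesis .
    qed
    also have "\<dots> \<le> (c1 + c2 + 1) * e\<^sup>2" using c2 by (intro mult_right_mono) auto
    finally show "norm (g_bar f l u (x + D_inv f l u x *v d)) \<le> (c1 + c2 + 1) * e\<^sup>2"
      unfolding h_def .
    have hess_x: "y \<bullet> (hess f x *v y) \<ge> - ((c\<theta> + cg) / r * e) * (norm y)\<^sup>2" for y
    proof -
      obtain z where z: "D_inv f l u x *v z = y" by (rule D_inv_surj[OF X(1)])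
      have "(sqrt r * norm z)\<^sup>2 \<le> (norm y)\<^sup>2"
        using norm_D_inv_mult_ge[OF X(1), of z] z sr by (intro power_mono) auto
      then have zy: "(norm z)\<^sup>2 \<le> (norm y)\<^sup>2 / r" using r by (simp add: power_mult_distrib field_simps)
      have "z \<bullet> (C_bar f l u x *v z) \<le> norm z * norm (C_bar f l u x *v z)"
        by (rule norm_cauchy_schwarz)
      also have "\<dots> \<le> norm z * (norm (grad f x) * norm z)"
        by (intro mult_left_mono norm_C_bar_mult_le) simp
      also have "\<dots> \<le> cg * e * (norm z)\<^sup>2"
        using mult_right_mono[OF g_le, of "(norm z)\<^sup>2"] by (simp add: power2_eq_square mult_ac)
      finally have C: "z \<bullet> (C_bar f l u x *v z) \<le> cg * e * (norm z)\<^sup>2" .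
      have "- \<theta> * (norm z)\<^sup>2 \<le> z \<bullet> (B_bar f l u x *v z)"
        using psd by (simp add: power2_norm_eq_inner)
      moreover have "\<theta> * (norm z)\<^sup>2 \<le> c\<theta> * e * (norm z)\<^sup>2" using \<theta>_le by (intro mult_right_mono) auto
      moreover have "z \<bullet> (B_bar f l u x *v z) = y \<bullet> (hess f x *v y) + z \<bullet> (C_bar f l u x *v z)"
        by (simp add: B_bar_quadratic_form z)
      ultimately have "- ((c\<theta> + cg) * e * (norm z)\<^sup>2) \<le> y \<bullet> (hess f x *v y)"
        using C by (simp add: algebra_simps)
      moreover have "(c\<theta> + cg) * e * (norm z)\<^sup>2 \<le> (c\<theta> + cg) * e * ((norm y)\<^sup>2 / r)"
        using zy c\<theta> cg e by (intro mult_left_mono) auto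
      ultimately show ?thesis by simp
    qed
    \<comment> \<open>Both x and x + h lie in X, so the Lipschitz bound for the Hessian applies to
      this pair directly.\<close>
    have hess_xh: "y \<bullet> (hess f (x + h) *v y) \<ge> - (((c\<theta> + cg) / r + 2 * \<gamma>D) * e) * (norm y)\<^sup>2" for y
    proof -
      have "\<bar>y \<bullet> ((hess f (x + h) - hess f x) *v y)\<bar> \<le> opnorm (hess f (x + h) - hess f x) * (norm y)\<^sup>2"
        by (rule abs_inner_matrix_le)
      also have "\<dots> \<le> (L * norm h) * (norm y)\<^sup>2"
        using lipschitz[of "x + h" x] X by (intro mult_right_mono) (auto simp: h_def)
      also have "\<dots> \<le> (2 * \<gamma>D * e) * (norm y)\<^sup>2"
        using mult_left_mono[OF h, of L] bounds by (intro mult_right_mono) (auto simp: mult_ac)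
      finally have "y \<bullet> ((hess f (x + h) - hess f x) *v y) \<ge> - ((2 * \<gamma>D * e) * (norm y)\<^sup>2)" by linarith
      then have "y \<bullet> (hess f (x + h) *v y) \<ge> y \<bullet> (hess f x *v y) - (2 * \<gamma>D * e) * (norm y)\<^sup>2"
        by (simp add: matrix_vector_mult_diff_rdistrib inner_diff_right)
      with hess_x[of y] show ?thesis by (simp add: algebra_simps)
    qed
    have "lambda_min (B_bar f l u (x + h)) \<ge> - (c2 * e)"
    proof (rule lambda_min_ge)
      show "transpose (B_bar f l u (x + h)) = B_bar f l u (x + h)"
        using X(2) by (intro transpose_B_bar hess_symmetric) (simp add: h_def)
      fix z
      let ?y = "D_inv f l u (x + h) *v z"
      have "(norm ?y)\<^sup>2 \<le> (\<gamma>D * norm z)\<^sup>2" using D'_le by (intro power_mono) auto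
      then have "((c\<theta> + cg) / r + 2 * \<gamma>D) * e * (norm ?y)\<^sup>2
          \<le> ((c\<theta> + cg) / r + 2 * \<gamma>D) * e * (\<gamma>D * norm z)\<^sup>2"
        using c\<theta> cg r bounds e by (intro mult_left_mono) auto
      also have "\<dots> = c2 * e * (z \<bullet> z)"
        by (simp add: c2_def power_mult_distrib power2_norm_eq_inner mult_ac)
      finally have "- (c2 * e) * (z \<bullet> z) \<le> ?y \<bullet> (hess f (x + h) *v ?y)"
        using hess_xh[of ?y] by simp
      \<comment> \<open>The new scaling enters only through its norm bound \<gamma>D; the new
        \<open>C_bar\<close> is dropped by its sign.\<close>
      then show "- (c2 * e) * (z \<bullet> z) \<le> z \<bullet> (B_bar f l u (x + h) *v z)"
        using C_bar_quadratic_form_nonneg[of z f l u "x + h"] by (simp add: B_bar_quadratic_form)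
    qed
    moreover have "c2 * e \<le> (c1 + c2 + 1) * e" using c1 e by (intro mult_right_mono) auto
    ultimately show "lambda_min (B_bar f l u (x + D_inv f l u x *v d)) \<ge> - (c1 + c2 + 1) * e"
      unfolding h_def by (simp add: algebra_simps)
  qed
qed

end

context small_tolerance_run
begin

text \<open>The stopping test reverses the inequality used for continuing iterations: \<Delta> |t|
  \<ge> norm s. In particular t is nonzero, and dividing the eigenvector equations by t gives
  equations for d = s / t.\<close>

lemma stopping_step:
  assumes "terminates_at f l u p x s t K"
  obtains d \<theta> where "x (Suc K) = x K + D_inv f l u (x K) *v d" "0 \<le> \<theta>" "norm d \<le> 2 * sqrt \<epsilon> / L"
    "B_bar f l u (x K) *v d + g_bar f l u (x K) = - \<theta> *\<^sub>R d"
    "g_bar f l u (x K) \<bullet> d = sqrt \<epsilon> - \<theta>"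
    "\<And>z. z \<bullet> (B_bar f l u (x K) *v z) \<ge> - \<theta> * (z \<bullet> z)"
proof -
  have K: "reached K" and stop: "stops p (t K)" using assms by (auto simp: terminates_at_def)
  let ?\<Delta> = "2 * sqrt \<epsilon> / L"
  obtain \<theta> where \<theta>: "\<theta> \<ge> sqrt \<epsilon>" "s K \<bullet> s K + (t K)\<^sup>2 = 1"
    "B_bar f l u (x K) *v s K + t K *\<^sub>R g_bar f l u (x K) = - \<theta> *\<^sub>R s K"
    "g_bar f l u (x K) \<bullet> s K = (sqrt \<epsilon> - \<theta>) * t K"
    "\<And>z. z \<bullet> (B_bar f l u (x K) *v z) \<ge> - \<theta> * (z \<bullet> z)"
    by (rule optimality[OF K]) blast
  have \<Delta>: "0 \<le> ?\<Delta>" using params by simp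
  have pos: "1 + ?\<Delta>\<^sup>2 > 0" by (smt (verit) zero_le_power2)
  have gt: "sqrt (1 / (1 + ?\<Delta>\<^sup>2)) < \<bar>t K\<bar>" using stop by (simp add: stops_def p)
  have "0 \<le> sqrt (1 / (1 + ?\<Delta>\<^sup>2))" using pos by (intro real_sqrt_ge_zero) auto
  then have "0 < \<bar>t K\<bar>" using gt by (rule le_less_trans)
  then have t0: "t K \<noteq> 0" by simp
  have "(sqrt (1 / (1 + ?\<Delta>\<^sup>2)))\<^sup>2 \<le> \<bar>t K\<bar>\<^sup>2"
    using gt \<open>0 \<le> sqrt (1 / (1 + ?\<Delta>\<^sup>2))\<close> by (intro power_mono) auto
  then have "1 / (1 + ?\<Delta>\<^sup>2) \<le> (t K)\<^sup>2" using pos by simp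
  then have "1 \<le> (t K)\<^sup>2 * (1 + ?\<Delta>\<^sup>2)" using pos by (simp only: pos_divide_le_eq)
  then have ss: "s K \<bullet> s K \<le> ?\<Delta>\<^sup>2 * (t K)\<^sup>2" using \<theta>(2) by (simp add: algebra_simps)
  define d where "d = (1 / t K) *\<^sub>R s K"
  have "(norm d)\<^sup>2 = (s K \<bullet> s K) / (t K)\<^sup>2"
    by (simp add: d_def power2_norm_eq_inner[symmetric] power_divide)
  also have "\<dots> \<le> ?\<Delta>\<^sup>2" using ss t0 by (simp add: pos_divide_le_eq)
  finally have nd: "norm d \<le> ?\<Delta>" using \<Delta> by (rule power2_le_imp_le)
  have "x (Suc K) = x K + direction f l u p (x K) (s K) (t K)"
    using run K stop by (simp add: sobasip_run_def)
  also have "direction f l u p (x K) (s K) (t K) = D_inv f l u (x K) *v d"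
    using stop by (simp add: direction_def d_bar_def d_def)
  finally have xK: "x (Suc K) = x K + D_inv f l u (x K) *v d" .
  have "B_bar f l u (x K) *v d + g_bar f l u (x K)
      = (1 / t K) *\<^sub>R (B_bar f l u (x K) *v s K + t K *\<^sub>R g_bar f l u (x K))"
    using t0 by (simp add: d_def matrix_vector_mult_scaleR scaleR_add_right)
  also have "\<dots> = - \<theta> *\<^sub>R d" unfolding \<theta>(3) by (simp add: d_def)
  finally have kkt: "B_bar f l u (x K) *v d + g_bar f l u (x K) = - \<theta> *\<^sub>R d" .
  show thesis
  proof (rule that[OF xK _ nd kkt _ \<theta>(5)])
    show "0 \<le> \<theta>" using \<theta>(1) params by (smt (verit) real_sqrt_ge_zero)
    show "g_bar f l u (x K) \<bullet> d = sqrt \<epsilon> - \<theta>" using \<theta>(4) t0 by (simp add: d_def)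
  qed
qed

end

section \<open>Uniform constants near the iterates\<close>

lemma open_strictly_feasible: "open (strictly_feasible l u)"
proof -
  have "strictly_feasible l u = (\<Inter>i. {x. l $ i < ereal (x $ i)} \<inter> {x. ereal (x $ i) < u $ i})"
    by (auto simp: strictly_feasible_def)
  moreover have "open {x :: real^'n. l $ i < ereal (x $ i)}" "open {x :: real^'n. ereal (x $ i) < u $ i}"
    for i and l u :: "ereal^'n"
    by (intro open_Collect_less continuous_intros)+
  ultimately show ?thesis by (auto intro!: open_INT open_Int)
qed

text \<open>Compactness of X yields one radius that works at all its points. Adding the closed ball
  of that radius to X keeps the set compact, so the continuous \<open>third_deriv_sum\<close> is
  bounded there, at trial points outside X as well.\<close>

lemma interior_region_exists:
  fixes f :: "real^'n \<Rightarrow> real"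
  assumes X: "compact X" "X \<subseteq> strictly_feasible l u" and smooth: "C_k_on 3 f X"
  obtains S r M where "interior_region f l u X S r M"
proof -
  obtain S where S: "open S" "X \<subseteq> S" "C_k_on_open 3 f S" using smooth by (auto simp: C_k_on_def)
  have "open (S \<inter> strictly_feasible l u)" using S(1) open_strictly_feasible by blast
  then obtain r0 where r0: "r0 > 0" "(\<Union>x\<in>X. cball x r0) \<subseteq> S \<inter> strictly_feasible l u"
    using compact_subset_open_imp_cball_epsilon_subset[OF X(1)] S(2) X(2) by (metis le_inf_iff)
  define r where "r = min r0 1"
  define N where "N = {x + y |x y. x \<in> X \<and> y \<in> cball 0 r}"
  have N: "cball x r \<subseteq> N" if "x \<in> X" for x
  proof
    fix y assume "y \<in> cball x r"
    then have "y = x + (y - x)" "y - x \<in> cball 0 r" by (auto simp: dist_norm norm_minus_commute)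
    then show "y \<in> N" unfolding N_def using that by blast
  qed
  have "N \<subseteq> S"
  proof
    fix z assume "z \<in> N"
    then obtain x y where "z = x + y" "x \<in> X" "y \<in> cball 0 r" by (auto simp: N_def)
    then have "z \<in> cball x r0" by (simp add: r_def dist_norm)
    then show "z \<in> S" using r0(2) \<open>x \<in> X\<close> by blast
  qed
  have "compact N" unfolding N_def using X(1) compact_cball by (rule compact_sums)
  have "continuous_on S (third_deriv_sum f)"
    using S(3) unfolding third_deriv_sum_def[abs_def]
    by (intro continuous_on_sum continuous_on_rabs) (simp add: numeral_3_eq_3)
  then have "continuous_on N (third_deriv_sum f)" using \<open>N \<subseteq> S\<close> by (rule continuous_on_subset)
  then have "bounded (third_deriv_sum f ` N)"
    using \<open>compact N\<close> by (intro compact_imp_bounded compact_continuous_image)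
  then obtain M where M: "M > 0" "\<And>y. y \<in> N \<Longrightarrow> \<bar>third_deriv_sum f y\<bar> \<le> M"
    by (auto simp: bounded_pos)
  have "interior_region f l u X S r M"
  proof
    show "0 < r" "r \<le> 1" using r0 by (auto simp: r_def)
    show "cball x r \<subseteq> S" "cball x r \<subseteq> strictly_feasible l u" if "x \<in> X" for x
    proof -
      have "cball x r \<subseteq> cball x r0" by (simp add: r_def subset_cball)
      then show "cball x r \<subseteq> S" "cball x r \<subseteq> strictly_feasible l u" using r0(2) that by blast+
    qed
    show "third_deriv_sum f y \<le> M" if "x \<in> X" "y \<in> cball x r" for x y
      using M(2)[of y] N that by fastforce
  qed (use S M in auto)
  then show thesis by (rule that)
qed

text \<open>G makes the multiplier \<theta> small at a stop; F replaces f(x_1), so that the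
  constants do not depend on the starting point.\<close>

lemma (in interior_region) bounded_on_region:
  assumes "compact X"
  obtains G F where "0 \<le> G" "\<And>x. x \<in> X \<Longrightarrow> norm (grad f x) \<le> G" "\<And>x. x \<in> X \<Longrightarrow> f x \<le> F"
proof -
  have XS: "x \<in> S" if "x \<in> X" for x using cball_S[OF that] r by auto
  have diff: "f differentiable (at x)" "partial_deriv f i differentiable (at x)" if "x \<in> S" for x i
    using C3 that by (simp_all add: numeral_3_eq_3)
  have "continuous_on X (grad f)" unfolding grad_def[abs_def]
    using diff XS by (intro continuous_on_vec_lambda differentiable_imp_continuous_on)
      (auto simp: differentiable_on_def intro: differentiable_at_withinI)
  then have "bounded (grad f ` X)" using assms by (intro compact_imp_bounded compact_continuous_image)
  then obtain G where G: "G > 0" "\<And>x. x \<in> X \<Longrightarrow> norm (grad f x) \<le> G" by (auto simp: bounded_pos)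
  have "continuous_on X f"
    using diff XS by (intro differentiable_imp_continuous_on)
      (auto simp: differentiable_on_def intro: differentiable_at_withinI)
  then have "bounded (f ` X)" using assms by (intro compact_imp_bounded compact_continuous_image)
  then obtain F where F: "\<And>x. x \<in> X \<Longrightarrow> \<bar>f x\<bar> \<le> F" by (auto simp: bounded_pos)
  show thesis
  proof (rule that[of G F])
    show "f x \<le> F" if "x \<in> X" for x using F[OF that] by linarith
  qed (use G in auto)
qed

text \<open>The last bound is stated for every admissible lower bound \<alpha> of the initial steps.
  The 1 in \<open>max\<close> allows for a run that stops at once with f(x_1) equal to the infimum:
  the product vanishes, yet one step has been taken.\<close>

theorem theorem1:
  fixes f :: "real^'n \<Rightarrow> real" and l u :: "ereal^'n" and X :: "(real^'n) set" and L\<^sub>H :: real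
  assumes bounds: "\<And>i. l $ i \<noteq> \<infinity> \<and> u $ i \<noteq> - \<infinity> \<and> l $ i < u $ i"
    and f_inf_finite: "bdd_below (f ` feasible l u)"
    and X: "closed X" "bounded X" "X \<subseteq> strictly_feasible l u"
    and smooth: "C_k_on 3 f X"
    and L\<^sub>H: "L\<^sub>H > 0" "\<And>x y. x \<in> X \<Longrightarrow> y \<in> X \<Longrightarrow> opnorm (hess f x - hess f y) \<le> L\<^sub>H * norm (x - y)"
  shows "\<exists>C\<^sub>0>0. \<forall>\<nu> \<gamma> \<beta> \<tau> U\<^sub>H \<gamma>\<^sub>D \<gamma>\<^sub>B.
    0 < \<nu> \<and> \<nu> < 1/2 \<and> \<gamma> > 0 \<and> 0 < \<beta> \<and> \<beta> < 1 \<and> 0 < \<tau> \<and> \<tau> < 1 \<and> U\<^sub>H > 0 \<and> \<gamma>\<^sub>D > 0 \<and> \<gamma>\<^sub>B > 0 \<longrightarrow>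
    (\<exists>C>0. \<exists>\<epsilon>\<^sub>0>0. \<forall>\<epsilon> p x s t.
       0 < \<epsilon> \<and> \<epsilon> < \<epsilon>\<^sub>0 \<and>
       p = \<lparr>par_nu = \<nu>, par_gamma = \<gamma>, par_beta = \<beta>, par_tau = \<tau>,
            par_Delta = 2 * sqrt \<epsilon> / L\<^sub>H, par_delta = sqrt \<epsilon>\<rparr> \<and>
       sobasip_run f l u p x s t \<and>
       (\<forall>k \<in> iterate_indices f l u p x s t.
          x k \<in> X \<and> opnorm (hess f (x k)) \<le> U\<^sub>H \<and>
          opnorm (D_inv f l u (x k)) \<le> \<gamma>\<^sub>D \<and> opnorm (B_bar f l u (x k)) \<le> \<gamma>\<^sub>B) \<longrightarrow>
       (\<exists>K. terminates_at f l u p x s t K \<and>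
          real (num_steps f l u p x s t K) \<le> C * (\<epsilon> powr (- 3/2) * log \<beta> \<epsilon>) \<and>
          norm (g_bar f l u (x (Suc K))) \<le> C * \<epsilon> \<and>
          lambda_min (B_bar f l u (x (Suc K))) \<ge> - C * sqrt \<epsilon> \<and>
          (\<forall>\<alpha>>0.
             (\<forall>k. reaches f l u p x s t k \<and> \<not> stops p (t k) \<longrightarrow>
                alpha_trial f l u p (x k) (s k) (t k) 0 \<ge> \<alpha>) \<longrightarrow>
             real (num_steps f l u p x s t K) \<le>
               max 1 (C\<^sub>0 *
                 (max (3 * L\<^sub>H ^ 3 / (4 * \<gamma> * \<alpha> ^ 3))
                      (2 * (L\<^sub>H * \<gamma>\<^sub>D ^ 3 + \<gamma>) ^ 3 / (9 * \<gamma> * \<beta> ^ 3))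
                  * \<lceil>log \<beta> (3 * sqrt \<epsilon> * \<nu> / (L\<^sub>H * \<gamma>\<^sub>D ^ 3 + \<gamma>))\<rceil>
                  * (f (x 1) - Inf (f ` feasible l u))
                  * \<epsilon> powr (- 3/2))))))"
proof -
  have "compact X" using X by (simp add: compact_eq_bounded_closed)
  obtain S r M where region: "interior_region f l u X S r M"
    by (rule interior_region_exists[OF \<open>compact X\<close> X(3) smooth])
  interpret interior_region f l u X S r M by (rule region)
  obtain G F where G: "0 \<le> G" "\<And>x. x \<in> X \<Longrightarrow> norm (grad f x) \<le> G" and F: "\<And>x. x \<in> X \<Longrightarrow> f x \<le> F"
    by (rule bounded_on_region[OF \<open>compact X\<close>]) blast
  \<comment> \<open>Taken at least 1 so that P \<le> \<kappa> Q also holds for the summand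
    \<gamma>.\<close>
  define \<kappa> where "\<kappa> = max 1 (M / L\<^sub>H)"
  have \<kappa>: "\<kappa> \<ge> 1" by (simp add: \<kappa>_def)
  have M\<kappa>: "M \<le> \<kappa> * L\<^sub>H" using L\<^sub>H(1) by (simp add: \<kappa>_def max_def field_simps)
  show ?thesis
  proof (rule exI[of _ "2 * \<kappa> ^ 3"], intro conjI allI impI)
    show "0 < 2 * \<kappa> ^ 3" using \<kappa> by simp
  next
    fix \<nu> \<gamma> \<beta> \<tau> U\<^sub>H \<gamma>\<^sub>D \<gamma>\<^sub>B :: real
    assume par: "0 < \<nu> \<and> \<nu> < 1/2 \<and> \<gamma> > 0 \<and> 0 < \<beta> \<and> \<beta> < 1 \<and> 0 < \<tau> \<and> \<tau> < 1 \<and> U\<^sub>H > 0 \<and> \<gamma>\<^sub>D > 0 \<and> \<gamma>\<^sub>B > 0"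
    have pos: "\<gamma>\<^sub>D > 0" "\<gamma>\<^sub>B > 0" using par by auto
    define P where "P = M * \<gamma>\<^sub>D ^ 3 + \<gamma>"
    define Q where "Q = L\<^sub>H * \<gamma>\<^sub>D ^ 3 + \<gamma>"
    have P: "P > 0" using par M_nonneg by (auto simp: P_def intro!: add_nonneg_pos)
    have Q: "Q > 0" using par L\<^sub>H(1) by (simp add: Q_def add_pos_pos)
    have PQ: "P \<le> \<kappa> * Q"
    proof -
      have "M * \<gamma>\<^sub>D ^ 3 \<le> \<kappa> * L\<^sub>H * \<gamma>\<^sub>D ^ 3" using M\<kappa> par by (intro mult_right_mono) auto
      moreover have "1 * \<gamma> \<le> \<kappa> * \<gamma>" using \<kappa> par by (intro mult_right_mono) auto
      ultimately show ?thesis by (simp add: P_def Q_def algebra_simps)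
    qed
    obtain C1 where C1: "C1 > 0" and stationary: "\<And>e x d \<theta>. 0 < e \<Longrightarrow> e \<le> 1 \<Longrightarrow> \<gamma>\<^sub>D * (2 * e / L\<^sub>H) \<le> r \<Longrightarrow>
      x \<in> X \<Longrightarrow> x + D_inv f l u x *v d \<in> X \<Longrightarrow> opnorm (D_inv f l u x) \<le> \<gamma>\<^sub>D \<Longrightarrow>
      opnorm (D_inv f l u (x + D_inv f l u x *v d)) \<le> \<gamma>\<^sub>D \<Longrightarrow> opnorm (B_bar f l u x) \<le> \<gamma>\<^sub>B \<Longrightarrow>
      0 \<le> \<theta> \<Longrightarrow> norm d \<le> 2 * e / L\<^sub>H \<Longrightarrow>
      B_bar f l u x *v d + g_bar f l u x = - \<theta> *\<^sub>R d \<Longrightarrow> g_bar f l u x \<bullet> d = e - \<theta> \<Longrightarrow>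
      (\<And>z. z \<bullet> (B_bar f l u x *v z) \<ge> - \<theta> * (z \<bullet> z)) \<Longrightarrow>
      norm (g_bar f l u (x + D_inv f l u x *v d)) \<le> C1 * e\<^sup>2 \<and>
      lambda_min (B_bar f l u (x + D_inv f l u x *v d)) \<ge> - C1 * e"
      using returned_point_stationary[OF pos L\<^sub>H(1) G(1) L\<^sub>H(2) G(2)] by blast
    define \<alpha>0 where "\<alpha>0 = \<tau> * min 1 (r * \<nu> / \<gamma>\<^sub>D)"
    have \<alpha>0: "\<alpha>0 > 0" using par r by (simp add: \<alpha>0_def)
    define W where "W = max (3 * L\<^sub>H ^ 3 / (4 * \<gamma> * \<alpha>0 ^ 3)) (2 * Q ^ 3 / (9 * \<gamma> * \<beta> ^ 3))"
    have W: "W \<ge> 0" using par Q by (simp add: W_def le_max_iff_disj)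
    \<comment> \<open>The explicit bound at \<alpha>0 with the worst value of f(x_1), stripped of
      its dependence on \<epsilon>.\<close>
    define C2 where "C2 = 2 * \<kappa> ^ 3 * (W * \<bar>F - Inf (f ` feasible l u)\<bar>)"
    have C2: "C2 \<ge> 0" using \<kappa> W by (simp add: C2_def)
    define c where "c = 3 * \<nu> / Q"
    have c: "c > 0" using par Q by (simp add: c_def)
    \<comment> \<open>The condition \<epsilon> < \<beta> powr b forces log_\<beta> \<epsilon> \<ge>
      b. Since \<Lambda> = log_\<beta>(\<epsilon>) / 2 + log_\<beta> c, the three entries yield
      log_\<beta> \<epsilon> \<ge> 1, the lower bound on \<Lambda> demanded by
      \<open>num_steps_bound\<close>, and \<Lambda> + 1 \<le> log_\<beta> \<epsilon>.\<close>
    define b where "b = max 1 (max (2 * (log \<beta> (1 / \<kappa>) + 4 - log \<beta> c)) (2 * (log \<beta> c + 1)))"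
    \<comment> \<open>Bounds for sqrt \<epsilon>, in order: tolerance at most 1, acceptable steps
      inside the ball of radius r, \<Delta> \<le> 1/2, and the final step inside that ball.\<close>
    define q where "q = min 1 (min (r * P / (3 * \<gamma>\<^sub>D)) (min (L\<^sub>H / 4) (r * L\<^sub>H / (2 * \<gamma>\<^sub>D))))"
    have q: "q > 0" using par r P L\<^sub>H(1) by (simp add: q_def)
    show "\<exists>C>0. \<exists>\<epsilon>\<^sub>0>0. \<forall>\<epsilon> p x s t.
       0 < \<epsilon> \<and> \<epsilon> < \<epsilon>\<^sub>0 \<and>
       p = \<lparr>par_nu = \<nu>, par_gamma = \<gamma>, par_beta = \<beta>, par_tau = \<tau>,
            par_Delta = 2 * sqrt \<epsilon> / L\<^sub>H, par_delta = sqrt \<epsilon>\<rparr> \<and>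
       sobasip_run f l u p x s t \<and>
       (\<forall>k \<in> iterate_indices f l u p x s t.
          x k \<in> X \<and> opnorm (hess f (x k)) \<le> U\<^sub>H \<and>
          opnorm (D_inv f l u (x k)) \<le> \<gamma>\<^sub>D \<and> opnorm (B_bar f l u (x k)) \<le> \<gamma>\<^sub>B) \<longrightarrow>
       (\<exists>K. terminates_at f l u p x s t K \<and>
          real (num_steps f l u p x s t K) \<le> C * (\<epsilon> powr (- 3/2) * log \<beta> \<epsilon>) \<and>
          norm (g_bar f l u (x (Suc K))) \<le> C * \<epsilon> \<and>
          lambda_min (B_bar f l u (x (Suc K))) \<ge> - C * sqrt \<epsilon> \<and>
          (\<forall>\<alpha>>0.
             (\<forall>k. reaches f l u p x s t k \<and> \<not> stops p (t k) \<longrightarrow>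
                alpha_trial f l u p (x k) (s k) (t k) 0 \<ge> \<alpha>) \<longrightarrow>
             real (num_steps f l u p x s t K) \<le>
               max 1 (2 * \<kappa> ^ 3 *
                 (max (3 * L\<^sub>H ^ 3 / (4 * \<gamma> * \<alpha> ^ 3))
                      (2 * (L\<^sub>H * \<gamma>\<^sub>D ^ 3 + \<gamma>) ^ 3 / (9 * \<gamma> * \<beta> ^ 3))
                  * \<lceil>log \<beta> (3 * sqrt \<epsilon> * \<nu> / (L\<^sub>H * \<gamma>\<^sub>D ^ 3 + \<gamma>))\<rceil>
                  * (f (x 1) - Inf (f ` feasible l u))
                  * \<epsilon> powr (- 3/2)))))"
    proof (rule exI[of _ "C1 + C2 + 1"], rule conjI[OF _ exI[of _ "min (q\<^sup>2) (\<beta> powr b)"]];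
        (intro conjI allI impI)?; (elim conjE)?)
      show "0 < C1 + C2 + 1" using C1 C2 by simp
      show "0 < min (q\<^sup>2) (\<beta> powr b)" using q par by simp
    next
      fix \<epsilon> :: real and p x s t
      assume \<epsilon>: "0 < \<epsilon>" "\<epsilon> < min (q\<^sup>2) (\<beta> powr b)"
        and p: "p = \<lparr>par_nu = \<nu>, par_gamma = \<gamma>, par_beta = \<beta>, par_tau = \<tau>,
            par_Delta = 2 * sqrt \<epsilon> / L\<^sub>H, par_delta = sqrt \<epsilon>\<rparr>"
        and run: "sobasip_run f l u p x s t"
        and iter: "\<forall>k \<in> iterate_indices f l u p x s t.
          x k \<in> X \<and> opnorm (hess f (x k)) \<le> U\<^sub>H \<and>
          opnorm (D_inv f l u (x k)) \<le> \<gamma>\<^sub>D \<and> opnorm (B_bar f l u (x k)) \<le> \<gamma>\<^sub>B"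
      have sq: "sqrt \<epsilon> \<le> q" using \<epsilon> q by (intro real_le_lsqrt) auto
      have \<epsilon>_small: "sqrt \<epsilon> \<le> 1" "3 * sqrt \<epsilon> / P \<le> r / \<gamma>\<^sub>D" "2 * sqrt \<epsilon> / L\<^sub>H \<le> 1/2"
          "\<gamma>\<^sub>D * (2 * sqrt \<epsilon> / L\<^sub>H) \<le> r"
        using sq P par L\<^sub>H(1) by (auto simp: q_def field_simps)
      have log_ge: "log \<beta> \<epsilon> \<ge> b"
      proof -
        have "ln \<epsilon> \<le> ln (\<beta> powr b)" using \<epsilon> by (intro ln_mono) auto
        then have "ln \<epsilon> \<le> b * ln \<beta>" using par by (simp add: ln_powr)
        moreover have "ln \<beta> < 0" using par by simp
        ultimately show ?thesis by (simp add: log_def neg_le_divide_eq)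
      qed
      interpret small_tolerance_run f l u X S r M \<nu> \<gamma> \<beta> \<tau> \<gamma>\<^sub>D L\<^sub>H \<epsilon> p x s t
        using par L\<^sub>H(1) \<epsilon> p run iter f_inf_finite \<epsilon>_small
        by unfold_locales (auto simp: P_def)
      define \<Lambda> where "\<Lambda> = log \<beta> (3 * sqrt \<epsilon> * \<nu> / Q)"
      have \<Lambda>: "\<Lambda> = log \<beta> \<epsilon> / 2 + log \<beta> c"
      proof -
        have "\<Lambda> = log \<beta> (sqrt \<epsilon> * c)" by (simp add: \<Lambda>_def c_def mult_ac)
        also have "\<dots> = log \<beta> (sqrt \<epsilon>) + log \<beta> c" using \<epsilon> c by (intro log_mult_pos) auto
        also have "log \<beta> (sqrt \<epsilon>) = log \<beta> \<epsilon> / 2" using \<epsilon> by (simp add: log_def ln_sqrt)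
        finally show ?thesis .
      qed
      have \<Lambda>_ge: "log \<beta> (1 / \<kappa>) + 4 \<le> \<Lambda>" and \<Lambda>_le: "\<Lambda> + 1 \<le> log \<beta> \<epsilon>" and log1: "1 \<le> log \<beta> \<epsilon>"
        using log_ge by (auto simp: \<Lambda> b_def)
      obtain K where K: "terminates_at f l u p x s t K" using terminates by blast
      have steps: "real (num_steps f l u p x s t K) \<le> max 1 (2 * \<kappa> ^ 3 *
          (max (3 * L\<^sub>H ^ 3 / (4 * \<gamma> * \<alpha> ^ 3)) (2 * (L\<^sub>H * \<gamma>\<^sub>D ^ 3 + \<gamma>) ^ 3 / (9 * \<gamma> * \<beta> ^ 3))
            * \<lceil>log \<beta> (3 * sqrt \<epsilon> * \<nu> / (L\<^sub>H * \<gamma>\<^sub>D ^ 3 + \<gamma>))\<rceil>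
            * (f (x 1) - Inf (f ` feasible l u)) * \<epsilon> powr (- 3/2)))"
        if "\<alpha> > 0" "\<forall>k. reaches f l u p x s t k \<and> \<not> stops p (t k) \<longrightarrow>
                alpha_trial f l u p (x k) (s k) (t k) 0 \<ge> \<alpha>" for \<alpha>
        using that \<Lambda>_ge PQ
        by (intro num_steps_bound[OF \<kappa> _ _ K]) (auto simp: \<Lambda>_def P_def Q_def)
      have order: "real (num_steps f l u p x s t K) \<le> (C1 + C2 + 1) * (\<epsilon> powr (- 3/2) * log \<beta> \<epsilon>)"
      proof -
        have x1: "reaches f l u p x s t 1" by (simp add: reaches_def)
        define \<Phi> where "\<Phi> = f (x 1) - Inf (f ` feasible l u)"
        have \<Phi>: "\<Phi> \<le> \<bar>F - Inf (f ` feasible l u)\<bar>"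
          using F[OF reached_iterate(1)[OF x1]] by (simp add: \<Phi>_def)
        \<comment> \<open>The telescoped decrease over zero iterations is just the comparison of
          f(x_1) with the infimum.\<close>
        have "\<Phi> \<ge> 0" using total_decrease[OF \<alpha>0, of 0] trial_0_bounds(1) x1 by (simp add: \<Phi>_def \<alpha>0_def)
        have e: "\<epsilon> powr (- 3/2) \<ge> 1"
        proof -
          have "\<epsilon> \<le> 1" using \<epsilon>_small(1) by simp
          then have "\<epsilon> powr 0 \<le> \<epsilon> powr (- 3/2)" using \<epsilon> by (intro powr_mono') auto
          then show ?thesis using \<epsilon> by simp
        qed
        have E: "\<epsilon> powr (- 3/2) * log \<beta> \<epsilon> \<ge> 1" (is "?E \<ge> 1")
          using mult_mono[OF e log1] log1 by simp
        have "real_of_int \<lceil>\<Lambda>\<rceil> \<le> log \<beta> \<epsilon>" using \<Lambda>_le of_int_ceiling_le_add_one[of \<Lambda>] by linarith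
        then have "W * \<lceil>\<Lambda>\<rceil> * \<Phi> \<le> W * log \<beta> \<epsilon> * \<bar>F - Inf (f ` feasible l u)\<bar>"
          using W \<Phi> \<open>\<Phi> \<ge> 0\<close> log1 by (intro mult_mono mult_left_mono) auto
        then have "2 * \<kappa> ^ 3 * (W * \<lceil>\<Lambda>\<rceil> * \<Phi> * \<epsilon> powr (- 3/2))
            \<le> 2 * \<kappa> ^ 3 * (W * log \<beta> \<epsilon> * \<bar>F - Inf (f ` feasible l u)\<bar> * \<epsilon> powr (- 3/2))"
          using \<kappa> by (intro mult_left_mono mult_right_mono) auto
        also have "\<dots> = C2 * ?E" by (simp add: C2_def mult_ac)
        also have "\<dots> \<le> (C1 + C2 + 1) * ?E" using C1 E by (intro mult_right_mono) auto
        finally have "2 * \<kappa> ^ 3 * (W * \<lceil>\<Lambda>\<rceil> * \<Phi> * \<epsilon> powr (- 3/2)) \<le> (C1 + C2 + 1) * ?E" .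
        \<comment> \<open>The summand 1 in the constant and ?E \<ge> 1 take care of the case in
          which \<open>max\<close> picks 1.\<close>
        moreover have "1 * 1 \<le> (C1 + C2 + 1) * ?E" using C1 C2 E by (intro mult_mono) auto
        moreover have "real (num_steps f l u p x s t K) \<le> max 1 (2 * \<kappa> ^ 3 * (W * \<lceil>\<Lambda>\<rceil> * \<Phi> * \<epsilon> powr (- 3/2)))"
          unfolding W_def \<Lambda>_def \<Phi>_def Q_def
          using \<alpha>0 trial_0_bounds(1) by (intro steps) (auto simp: \<alpha>0_def)
        ultimately show ?thesis by (simp only: max_def mult_1 split: if_splits)
      qed
      obtain d \<theta> where xK: "x (Suc K) = x K + D_inv f l u (x K) *v d"
        and step: "0 \<le> \<theta>" "norm d \<le> 2 * sqrt \<epsilon> / L\<^sub>H"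
          "B_bar f l u (x K) *v d + g_bar f l u (x K) = - \<theta> *\<^sub>R d"
          "g_bar f l u (x K) \<bullet> d = sqrt \<epsilon> - \<theta>"
          "\<And>z. z \<bullet> (B_bar f l u (x K) *v z) \<ge> - \<theta> * (z \<bullet> z)"
        by (rule stopping_step[OF K]) blast
      have "K \<in> iterate_indices f l u p x s t" "Suc K \<in> iterate_indices f l u p x s t"
        using K by (auto simp: iterate_indices_def terminates_at_def)
      then have "norm (g_bar f l u (x K + D_inv f l u (x K) *v d)) \<le> C1 * (sqrt \<epsilon>)\<^sup>2 \<and>
          lambda_min (B_bar f l u (x K + D_inv f l u (x K) *v d)) \<ge> - C1 * sqrt \<epsilon>"
        using iter \<epsilon> \<epsilon>_small by (intro stationary[OF _ _ _ _ _ _ _ _ step]) (auto simp flip: xK)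
      then have "norm (g_bar f l u (x (Suc K))) \<le> C1 * \<epsilon>"
          "lambda_min (B_bar f l u (x (Suc K))) \<ge> - C1 * sqrt \<epsilon>"
        unfolding xK using \<epsilon> by auto
      moreover have "C1 * \<epsilon> \<le> (C1 + C2 + 1) * \<epsilon>" "C1 * sqrt \<epsilon> \<le> (C1 + C2 + 1) * sqrt \<epsilon>"
        using C2 \<epsilon> by (auto intro!: mult_right_mono)
      ultimately have "norm (g_bar f l u (x (Suc K))) \<le> (C1 + C2 + 1) * \<epsilon>"
          "lambda_min (B_bar f l u (x (Suc K))) \<ge> - (C1 + C2 + 1) * sqrt \<epsilon>"
        unfolding mult_minus_left by linarith+
      with K order steps show "\<exists>K. terminates_at f l u p x s t K \<and>
          real (num_steps f l u p x s t K) \<le> (C1 + C2 + 1) * (\<epsilon> powr (- 3/2) * log \<beta> \<epsilon>) \<and>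
          norm (g_bar f l u (x (Suc K))) \<le> (C1 + C2 + 1) * \<epsilon> \<and>
          lambda_min (B_bar f l u (x (Suc K))) \<ge> - (C1 + C2 + 1) * sqrt \<epsilon> \<and>
          (\<forall>\<alpha>>0.
             (\<forall>k. reaches f l u p x s t k \<and> \<not> stops p (t k) \<longrightarrow>
                alpha_trial f l u p (x k) (s k) (t k) 0 \<ge> \<alpha>) \<longrightarrow>
             real (num_steps f l u p x s t K) \<le>
               max 1 (2 * \<kappa> ^ 3 *
                 (max (3 * L\<^sub>H ^ 3 / (4 * \<gamma> * \<alpha> ^ 3))
                      (2 * (L\<^sub>H * \<gamma>\<^sub>D ^ 3 + \<gamma>) ^ 3 / (9 * \<gamma> * \<beta> ^ 3))
                  * \<lceil>log \<beta> (3 * sqrt \<epsilon> * \<nu> / (L\<^sub>H * \<gamma>\<^sub>D ^ 3 + \<gamma>))\<rceil>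
                  * (f (x 1) - Inf (f ` feasible l u))
                  * \<epsilon> powr (- 3/2))))"
        by (intro exI[of _ K] conjI allI impI)
    qed
  qed
qed

end
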